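(* Let $\Pi$ be a Nambu-Poisson tensor of order $n\ge3$ on a smooth manifold $M$, let $B$ be a closed $n$-form on $M$ such that the bundle map $Id+\widetilde B\circ\Pi^\sharp:\Lambda^{n-1}T^*M\to\Lambda^{n-1}T^*M$ is invertible, and let $\mathcal T_B(\Pi)$ be the gauge transformation of $\Pi$ associated with $B$. Then the gauge equivalent Nambu-Poisson structures $\Pi$ and $\mathcal T_B(\Pi)$ give rise to the same characteristic distribution on $M$.
   Context: A Nambu-Poisson structure of order $n$ on a smooth manifold $M$ ($n\le\dim M$) is an $n$-multilinear skew-symmetric bracket $\{,\ldots,\}$ on $C^\infty(M)$ satisfying the Leibniz rule $\{f_1,\ldots,f_{n-1},gh\}=g\{f_1,\ldots,f_{n-1},h\}+\{f_1,\ldots,f_{n-1},g\}h$ and the fundamental identity $\{g_1,\ldots,g_{n-1},\{f_1,\ldots,f_n\}\}=\sum_{k=1}^n\{f_1,\ldots,f_{k-1},\{g_1,\ldots,g_{n-1},f_k\},\ldots,f_n\}$. It is identified with its Nambu tensor $\Pi\in\Gamma(\Lambda^nTM)$, $\Pi(df_1,\ldots,df_n)=\{f_1,\ldots,f_n\}$, and $\Pi^\sharp:\Lambda^{n-1}T^*M\to TM$ is given by $\langle\beta,\Pi^\sharp(\alpha_1\wedge\cdots\wedge\alpha_{n-1})\rangle=\Pi(\alpha_1,\ldots,\alpha_{n-1},\beta)$. The Hamiltonian vector field of $f_1,\ldots,f_{n-1}\in C^\infty(M)$ is $X_{f_1,\ldots,f_{n-1}}=\Pi^\sharp(df_1\wedge\cdots\wedge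 df_{n-1})$. The characteristic distribution assigns to each $m\in M$ the subspace $\mathcal D_mM\subset T_mM$ generated by the values at $m$ of all Hamiltonian vector fields. Gauge transformation: let $\widetilde B:TM\to\Lambda^{n-1}T^*M$, $X\mapsto i_XB$. If $Id+\widetilde B\circ\Pi^\sharp$ is invertible, $\mathcal T_B(\Pi)\in\Gamma(\Lambda^nTM)$ is the Nambu-Poisson tensor determined by $\mathcal T_B(\Pi)^\sharp=\Pi^\sharp(Id+\widetilde B\circ\Pi^\sharp)^{-1}$ (the right-hand side is skew-symmetric, and the resulting tensor is a Nambu-Poisson tensor). $\Pi$ and $\mathcal T_B(\Pi)$ are called gauge equivalent. *)

theory Defs
  imports "HOL-Analysis.Analysis" "HOL-Library.Function_Algebras"
begin

section \<open>Linear algebra on subspaces of function spaces\<close>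

instantiation "fun" :: (type, real_vector) real_vector
begin

definition scaleR_fun_def: "c *\<^sub>R f = (\<lambda>x. c *\<^sub>R f x)"

instance
  by standard (simp_all add: scaleR_fun_def fun_eq_iff algebra_simps)

end

lemma scaleR_fun_apply [simp]: "(c *\<^sub>R f) x = c *\<^sub>R f x"
  by (simp add: scaleR_fun_def)

definition linear_on :: "'v::real_vector set \<Rightarrow> ('v \<Rightarrow> 'w::real_vector) \<Rightarrow> bool" where
  "linear_on V F \<longleftrightarrow>
     (\<forall>u\<in>V. \<forall>v\<in>V. \<forall>a b. F (a *\<^sub>R u + b *\<^sub>R v) = a *\<^sub>R F u + b *\<^sub>R F v)"

definition multilinear_on :: "nat \<Rightarrow> 'v::real_vector set \<Rightarrow> ('v list \<Rightarrow> real) \<Rightarrow> bool" where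
  "multilinear_on k V F \<longleftrightarrow>
     (\<forall>xs i. length xs = k \<and> set xs \<subseteq> V \<and> i < k \<longrightarrow> linear_on V (\<lambda>v. F (xs[i := v])))"

definition skew_symmetric_on :: "nat \<Rightarrow> 'v set \<Rightarrow> ('v list \<Rightarrow> real) \<Rightarrow> bool" where
  "skew_symmetric_on k V F \<longleftrightarrow>
     (\<forall>xs i j. length xs = k \<and> set xs \<subseteq> V \<and> i < j \<and> j < k \<longrightarrow>
        F (xs[i := xs ! j, j := xs ! i]) = - F xs)"

text \<open>Maps on a subspace \<open>V\<close> are extended by zero, so that two of them are equal in HOL
  iff they agree on \<open>V\<close>.\<close>

definition dual_space :: "'v::real_vector set \<Rightarrow> ('v \<Rightarrow> real) set" where
  "dual_space V = {\<alpha>. linear_on V \<alpha> \<and> (\<forall>v. v \<notin> V \<longrightarrow> \<alpha> v = 0)}"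

text \<open>The exterior power \<open>\<Lambda>\<^sup>k V\<^sup>*\<close> is realised as the space of skew-symmetric \<open>k\<close>-linear forms
  on \<open>V\<close>; for finite-dimensional \<open>V\<close>, \<open>\<Lambda>\<^sup>k V\<close> is the space of such forms on \<open>V\<^sup>*\<close>.\<close>

definition alt_forms :: "nat \<Rightarrow> 'v::real_vector set \<Rightarrow> ('v list \<Rightarrow> real) set" where
  "alt_forms k V = {\<omega>. multilinear_on k V \<omega> \<and> skew_symmetric_on k V \<omega> \<and>
     (\<forall>vs. \<not> (length vs = k \<and> set vs \<subseteq> V) \<longrightarrow> \<omega> vs = 0)}"

text \<open>\<open>\<alpha>\<^sub>1 \<and> \<dots> \<and> \<alpha>\<^sub>k\<close>, in the normalisation \<open>(\<alpha>\<^sub>1 \<and> \<dots> \<and> \<alpha>\<^sub>k)(v\<^sub>1, \<dots>, v\<^sub>k) = det (\<alpha>\<^sub>i(v\<^sub>j))\<close>.\<close>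

definition wedge :: "'v::real_vector set \<Rightarrow> ('v \<Rightarrow> real) list \<Rightarrow> 'v list \<Rightarrow> real" where
  "wedge V \<alpha>s vs =
     (if length vs = length \<alpha>s \<and> set vs \<subseteq> V
      then \<Sum>p | p permutes {..<length \<alpha>s}.
             of_int (sign p) * (\<Prod>i<length \<alpha>s. (\<alpha>s ! i) (vs ! p i))
      else 0)"

definition interior_product :: "'v \<Rightarrow> ('v list \<Rightarrow> real) \<Rightarrow> 'v list \<Rightarrow> real" where
  "interior_product v b = (\<lambda>vs. b (v # vs))"

text \<open>For an \<open>n\<close>-vector \<open>P\<close> over \<open>V\<close>: the linear map \<open>P\<^sup>\<sharp> : \<Lambda>\<^sup>n\<^sup>-\<^sup>1 V\<^sup>* \<rightarrow> V\<close> with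
  \<open>\<langle>\<beta>, P\<^sup>\<sharp>(\<alpha>\<^sub>1 \<and> \<dots> \<and> \<alpha>\<^sub>n\<^sub>-\<^sub>1)\<rangle> = P(\<alpha>\<^sub>1, \<dots>, \<alpha>\<^sub>n\<^sub>-\<^sub>1, \<beta>)\<close>.\<close>

definition sharp :: "nat \<Rightarrow> 'v::real_vector set \<Rightarrow> (('v \<Rightarrow> real) list \<Rightarrow> real) \<Rightarrow>
    ('v list \<Rightarrow> real) \<Rightarrow> 'v" where
  "sharp n V P = (THE L.
     linear_on (alt_forms (n - 1) V) L \<and>
     (\<forall>\<omega>\<in>alt_forms (n - 1) V. L \<omega> \<in> V) \<and>
     (\<forall>\<omega>. \<omega> \<notin> alt_forms (n - 1) V \<longrightarrow> L \<omega> = 0) \<and>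
     (\<forall>\<alpha>s \<beta>. length \<alpha>s = n - 1 \<and> set \<alpha>s \<subseteq> dual_space V \<and> \<beta> \<in> dual_space V \<longrightarrow>
        \<beta> (L (wedge V \<alpha>s)) = P (\<alpha>s @ [\<beta>])))"

definition id_plus_flat_sharp :: "nat \<Rightarrow> 'v::real_vector set \<Rightarrow> (('v \<Rightarrow> real) list \<Rightarrow> real) \<Rightarrow>
    ('v list \<Rightarrow> real) \<Rightarrow> ('v list \<Rightarrow> real) \<Rightarrow> ('v list \<Rightarrow> real)" where
  "id_plus_flat_sharp n V P b \<omega> = \<omega> + interior_product (sharp n V P \<omega>) b"


section \<open>Smooth manifolds\<close>

text \<open>\<open>C\<^sup>k\<close> maps on an open subset \<open>S\<close> of a Euclidean space.\<close>

primrec Ck_on :: "nat \<Rightarrow> 'b::euclidean_space set \<Rightarrow> ('b \<Rightarrow> 'c::real_normed_vector) \<Rightarrow> bool" where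
  "Ck_on 0 S f \<longleftrightarrow> continuous_on S f"
| "Ck_on (Suc k) S f \<longleftrightarrow> (\<forall>x\<in>S. f differentiable (at x)) \<and>
     (\<forall>v. Ck_on k S (\<lambda>x. frechet_derivative f (at x) v))"

definition smooth_on :: "'b::euclidean_space set \<Rightarrow> ('b \<Rightarrow> 'c::real_normed_vector) \<Rightarrow> bool" where
  "smooth_on S f \<longleftrightarrow> (\<forall>k. Ck_on k S f)"

text \<open>An atlas is a set of charts \<open>(U, \<phi>)\<close>, where only the values of \<open>\<phi>\<close> on \<open>U\<close> matter; it need
  not be maximal. The model space \<^typ>\<open>'b\<close> fixes the dimension of the manifold.\<close>

type_synonym ('a, 'b) atlas = "('a set \<times> ('a \<Rightarrow> 'b)) set"

definition smooth_manifold :: "'a topology \<Rightarrow> ('a, 'b::euclidean_space) atlas \<Rightarrow> bool" where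
  "smooth_manifold X A \<longleftrightarrow>
     Hausdorff_space X \<and> second_countable X \<and>
     (\<Union>(U, \<phi>)\<in>A. U) = topspace X \<and>
     (\<forall>(U, \<phi>)\<in>A. openin X U \<and> open (\<phi> ` U) \<and>
        homeomorphic_map (subtopology X U) (top_of_set (\<phi> ` U)) \<phi>) \<and>
     (\<forall>(U, \<phi>)\<in>A. \<forall>(V, \<psi>)\<in>A. smooth_on (\<phi> ` (U \<inter> V)) (\<psi> \<circ> inv_into U \<phi>))"

definition points :: "('a, 'b) atlas \<Rightarrow> 'a set" where
  "points A = (\<Union>(U, \<phi>)\<in>A. U)"

text \<open>\<open>C\<^sup>\<infinity>(M)\<close>. The values of a function outside \<open>M\<close> are irrelevant.\<close>

definition smooth_functions :: "('a, 'b::euclidean_space) atlas \<Rightarrow> ('a \<Rightarrow> real) set" where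
  "smooth_functions A = {f. \<forall>(U, \<phi>)\<in>A. smooth_on (\<phi> ` U) (f \<circ> inv_into U \<phi>)}"

text \<open>Tangent vectors at \<open>m\<close> are the derivations at \<open>m\<close> of \<open>C\<^sup>\<infinity>(M)\<close>.\<close>

type_synonym 'a tangent_vector = "('a \<Rightarrow> real) \<Rightarrow> real"
type_synonym 'a covector = "'a tangent_vector \<Rightarrow> real"

definition tangent_space :: "('a, 'b::euclidean_space) atlas \<Rightarrow> 'a \<Rightarrow> 'a tangent_vector set" where
  "tangent_space A m = {v \<in> dual_space (smooth_functions A).
     \<forall>f\<in>smooth_functions A. \<forall>g\<in>smooth_functions A. v (f * g) = f m * v g + g m * v f}"

definition cotangent_space :: "('a, 'b::euclidean_space) atlas \<Rightarrow> 'a \<Rightarrow> 'a covector set" where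
  "cotangent_space A m = dual_space (tangent_space A m)"

definition differential ::
    "('a, 'b::euclidean_space) atlas \<Rightarrow> ('a \<Rightarrow> real) \<Rightarrow> 'a \<Rightarrow> 'a covector" where
  "differential A f m = (\<lambda>v. if v \<in> tangent_space A m then v f else 0)"

definition vector_fields ::
    "('a, 'b::euclidean_space) atlas \<Rightarrow> ('a \<Rightarrow> 'a tangent_vector) set" where
  "vector_fields A = {X. (\<forall>m\<in>points A. X m \<in> tangent_space A m) \<and>
     (\<forall>f\<in>smooth_functions A. (\<lambda>m. X m f) \<in> smooth_functions A)}"

definition lie_bracket :: "('a, 'b::euclidean_space) atlas \<Rightarrow> ('a \<Rightarrow> 'a tangent_vector) \<Rightarrow>
    ('a \<Rightarrow> 'a tangent_vector) \<Rightarrow> 'a \<Rightarrow> 'a tangent_vector" where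
  "lie_bracket A X Y m =
     (\<lambda>f. if f \<in> smooth_functions A then X m (\<lambda>p. Y p f) - Y m (\<lambda>p. X p f) else 0)"


section \<open>Differential forms\<close>

type_synonym 'a form_field = "'a \<Rightarrow> 'a tangent_vector list \<Rightarrow> real"

definition smooth_forms :: "('a, 'b::euclidean_space) atlas \<Rightarrow> nat \<Rightarrow> 'a form_field set" where
  "smooth_forms A k = {B. (\<forall>m\<in>points A. B m \<in> alt_forms k (tangent_space A m)) \<and>
     (\<forall>Xs. length Xs = k \<and> set Xs \<subseteq> vector_fields A \<longrightarrow>
        (\<lambda>m. B m (map (\<lambda>X. X m) Xs)) \<in> smooth_functions A)}"

text \<open>\<open>(dB)(X\<^sub>0, \<dots>, X\<^sub>k) = \<Sum>\<^sub>i (-1)\<^sup>i X\<^sub>i(B(\<dots>, X\<^sub>i omitted, \<dots>))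
    + \<Sum>\<^sub>i\<^sub><\<^sub>j (-1)\<^sup>i\<^sup>+\<^sup>j B([X\<^sub>i, X\<^sub>j], \<dots>, X\<^sub>i and X\<^sub>j omitted, \<dots>)\<close>.\<close>

definition exterior_derivative :: "('a, 'b::euclidean_space) atlas \<Rightarrow> 'a form_field \<Rightarrow>
    ('a \<Rightarrow> 'a tangent_vector) list \<Rightarrow> 'a \<Rightarrow> real" where
  "exterior_derivative A B Xs m =
     (\<Sum>i<length Xs. (-1) ^ i * (Xs ! i) m (\<lambda>p. B p (map (\<lambda>X. X p) (nths Xs (- {i}))))) +
     (\<Sum>j<length Xs. \<Sum>i<j. (-1) ^ (i + j) *
        B m (map (\<lambda>X. X m) (lie_bracket A (Xs ! i) (Xs ! j) # nths Xs (- {i, j}))))"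

definition closed_form :: "('a, 'b::euclidean_space) atlas \<Rightarrow> nat \<Rightarrow> 'a form_field \<Rightarrow> bool" where
  "closed_form A k B \<longleftrightarrow> B \<in> smooth_forms A k \<and>
     (\<forall>Xs. length Xs = k + 1 \<and> set Xs \<subseteq> vector_fields A \<longrightarrow>
        (\<forall>m\<in>points A. exterior_derivative A B Xs m = 0))"


section \<open>Nambu-Poisson structures\<close>

type_synonym 'a bracket = "('a \<Rightarrow> real) list \<Rightarrow> 'a \<Rightarrow> real"
type_synonym 'a multivector_field = "'a \<Rightarrow> 'a covector list \<Rightarrow> real"

definition nambu_poisson_structure ::
    "('a, 'b::euclidean_space) atlas \<Rightarrow> nat \<Rightarrow> 'a bracket \<Rightarrow> bool" where
  "nambu_poisson_structure A n br \<longleftrightarrow>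
     n \<le> DIM('b) \<and>
     (\<forall>fs. length fs = n \<and> set fs \<subseteq> smooth_functions A \<longrightarrow> br fs \<in> smooth_functions A) \<and>
     (\<forall>m\<in>points A. multilinear_on n (smooth_functions A) (\<lambda>fs. br fs m) \<and>
        skew_symmetric_on n (smooth_functions A) (\<lambda>fs. br fs m)) \<and>
     (\<forall>fs g h. length fs = n - 1 \<and> set fs \<subseteq> smooth_functions A \<and>
        g \<in> smooth_functions A \<and> h \<in> smooth_functions A \<longrightarrow>
        (\<forall>m\<in>points A. br (fs @ [g * h]) m = g m * br (fs @ [h]) m + br (fs @ [g]) m * h m)) \<and>
     (\<forall>gs fs. length gs = n - 1 \<and> set gs \<subseteq> smooth_functions A \<and>
        length fs = n \<and> set fs \<subseteq> smooth_functions A \<longrightarrow>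
        (\<forall>m\<in>points A. br (gs @ [br fs]) m = (\<Sum>k<n. br (fs[k := br (gs @ [fs ! k])]) m)))"

text \<open>Smoothness of the tensor \<open>P\<close> is contained in the requirement that its bracket maps smooth
  functions to smooth functions.\<close>

definition nambu_poisson_tensor ::
    "('a, 'b::euclidean_space) atlas \<Rightarrow> nat \<Rightarrow> 'a multivector_field \<Rightarrow> bool" where
  "nambu_poisson_tensor A n P \<longleftrightarrow>
     (\<forall>m\<in>points A. P m \<in> alt_forms n (cotangent_space A m)) \<and>
     nambu_poisson_structure A n (\<lambda>fs m. P m (map (\<lambda>f. differential A f m) fs))"

definition hamiltonian_vector_field :: "('a, 'b::euclidean_space) atlas \<Rightarrow> nat \<Rightarrow>
    'a multivector_field \<Rightarrow> ('a \<Rightarrow> real) list \<Rightarrow> 'a \<Rightarrow> 'a tangent_vector" where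
  "hamiltonian_vector_field A n P fs m =
     sharp n (tangent_space A m) (P m)
       (wedge (tangent_space A m) (map (\<lambda>f. differential A f m) fs))"

definition characteristic_distribution :: "('a, 'b::euclidean_space) atlas \<Rightarrow> nat \<Rightarrow>
    'a multivector_field \<Rightarrow> 'a \<Rightarrow> 'a tangent_vector set" where
  "characteristic_distribution A n P m =
     span {hamiltonian_vector_field A n P fs m | fs.
       length fs = n - 1 \<and> set fs \<subseteq> smooth_functions A}"


section \<open>Gauge transformations\<close>

definition gauge_invertible :: "('a, 'b::euclidean_space) atlas \<Rightarrow> nat \<Rightarrow>
    'a multivector_field \<Rightarrow> 'a form_field \<Rightarrow> bool" where
  "gauge_invertible A n P B \<longleftrightarrow>
     (\<forall>m\<in>points A. bij_betw (id_plus_flat_sharp n (tangent_space A m) (P m) (B m))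
        (alt_forms (n - 1) (tangent_space A m)) (alt_forms (n - 1) (tangent_space A m)))"

text \<open>With \<open>b X = i\<^sub>X B\<close>, the equation \<open>\<T>\<^sub>B(P)\<^sup>\<sharp> = P\<^sup>\<sharp> \<circ> (Id + b \<circ> P\<^sup>\<sharp>)\<^sup>-\<^sup>1\<close> determines \<open>\<T>\<^sub>B(P)\<close>, since
  by the definition of \<open>\<sharp>\<close> it reads
  \<open>\<T>\<^sub>B(P)(\<alpha>\<^sub>1, \<dots>, \<alpha>\<^sub>n) = \<langle>\<alpha>\<^sub>n, P\<^sup>\<sharp> ((Id + b \<circ> P\<^sup>\<sharp>)\<^sup>-\<^sup>1 (\<alpha>\<^sub>1 \<and> \<dots> \<and> \<alpha>\<^sub>n\<^sub>-\<^sub>1))\<rangle>\<close>.\<close>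

definition gauge_transformation :: "('a, 'b::euclidean_space) atlas \<Rightarrow> nat \<Rightarrow>
    'a form_field \<Rightarrow> 'a multivector_field \<Rightarrow> 'a multivector_field" where
  "gauge_transformation A n B P m \<alpha>s =
     (if length \<alpha>s = n \<and> set \<alpha>s \<subseteq> cotangent_space A m then
        last \<alpha>s (sharp n (tangent_space A m) (P m)
          (inv_into (alt_forms (n - 1) (tangent_space A m))
            (id_plus_flat_sharp n (tangent_space A m) (P m) (B m))
            (wedge (tangent_space A m) (butlast \<alpha>s))))
      else 0)"

end

theory Submission
  imports Defs
begin

text \<open>
The statement is pointwise. At a point \<open>m\<close>, the defining equation of the gauge transformation,
\<open>\<T>\<^sub>B(P)\<^sup>\<sharp> = P\<^sup>\<sharp> \<circ> (Id + b \<circ> P\<^sup>\<sharp>)\<^sup>-\<^sup>1\<close>, precomposes \<open>P\<^sup>\<sharp>\<close> with a bijection of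
\<open>\<Lambda>\<^sup>n\<^sup>-\<^sup>1 T\<^sub>m\<^sup>*M\<close>, so \<open>P\<^sup>\<sharp>\<close> and \<open>\<T>\<^sub>B(P)\<^sup>\<sharp>\<close> have the same image (\<open>sharp_gauge\<close>). The characteristic
distribution at \<open>m\<close> is exactly this image (\<open>characteristic_distribution_eq_range\<close>): every covector
at \<open>m\<close> is the differential of a global smooth function (\<open>cotangent_space_eq\<close>), and the wedges of
covectors span the space of alternating forms (\<open>span_sharp_wedge\<close>).

Behind this stands the fact that \<open>P\<^sup>\<sharp>\<close>, introduced by a definite description, really is the map
determined by its values on wedges. Both its existence (\<open>is_sharp_sharp\<close>) and its uniqueness
(\<open>is_sharp_unique\<close>) rest on the expansion of alternating forms and covectors in a finite frame of the
tangent space. Tangent vectors being derivations of the algebra of global smooth functions, such a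
frame has to be constructed (\<open>tangent_frame\<close>): bump functions globalise the coordinates of a chart, and
Hadamard's lemma \<open>F(x) = F(a) + \<Sum>\<^sub>b (x\<^sub>b - a\<^sub>b) g\<^sub>b(x)\<close> shows that a derivation at \<open>m\<close> is determined by its
values on them.
\<close>

section \<open>Calculus of \<open>C\<^sup>k\<close> maps\<close>

lemma Ck_on_SucD:
  assumes "Ck_on (Suc k) S f"
  shows "x \<in> S \<Longrightarrow> (f has_derivative frechet_derivative f (at x)) (at x)"
    and "Ck_on k S (\<lambda>x. frechet_derivative f (at x) v)"
  using assms by (auto simp: frechet_derivative_works)

lemma Ck_on_transform:
  assumes "open S" "\<And>x. x \<in> S \<Longrightarrow> f x = g x" "Ck_on k S f"
  shows "Ck_on k S g"
  using assms(2,3)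
proof (induction k arbitrary: f g)
  case 0
  then show ?case using continuous_on_cong[of S S f g] by simp
next
  case (Suc k)
  have der: "(g has_derivative frechet_derivative f (at x)) (at x)" if "x \<in> S" for x
    using has_derivative_transform_within_open[OF Ck_on_SucD(1)[OF Suc.prems(2) that] assms(1) that]
      Suc.prems(1) .
  have "Ck_on k S (\<lambda>x. frechet_derivative g (at x) v)" for v
  proof (rule Suc.IH[OF _ Ck_on_SucD(2)[OF Suc.prems(2), of v]])
    fix x assume "x \<in> S"
    show "frechet_derivative f (at x) v = frechet_derivative g (at x) v"
      using frechet_derivative_at[OF der[OF \<open>x \<in> S\<close>]] by simp
  qed
  then show ?case using der by (auto simp: differentiable_def)
qed

text \<open>\<^const>\<open>Ck_on\<close> speaks of the derivative that \<^const>\<open>frechet_derivative\<close> chooses. All closure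
properties below go through this rule, where any explicitly known derivative may be used.\<close>

lemma Ck_on_SucI:
  assumes "open S" "\<And>x. x \<in> S \<Longrightarrow> (f has_derivative f' x) (at x)"
    and "\<And>v. Ck_on k S (\<lambda>x. f' x v)"
  shows "Ck_on (Suc k) S f"
proof -
  have "Ck_on k S (\<lambda>x. frechet_derivative f (at x) v)" for v
  proof (rule Ck_on_transform[OF assms(1) _ assms(3)[of v]])
    fix x assume "x \<in> S"
    show "f' x v = frechet_derivative f (at x) v"
      using frechet_derivative_at[OF assms(2)[OF \<open>x \<in> S\<close>]] by simp
  qed
  then show ?thesis using assms(2) by (auto simp: differentiable_def)
qed

lemma Ck_on_pred: "Ck_on (Suc k) S f \<Longrightarrow> Ck_on k S f"
proof (induction k arbitrary: f)
  case 0
  then show ?case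
    by (auto intro!: differentiable_imp_continuous_on differentiable_at_imp_differentiable_on)
next
  case (Suc k)
  then show ?case by (auto simp: Suc.IH)
qed

lemma Ck_on_subset: "Ck_on k S f \<Longrightarrow> T \<subseteq> S \<Longrightarrow> Ck_on k T f"
  by (induction k arbitrary: f) (auto intro: continuous_on_subset)

text \<open>Differentiability on open sets is local. Functions that are extended by zero outside a compact
subset of a chart are smooth by this lemma.\<close>

lemma Ck_on_Un:
  "open S \<Longrightarrow> open T \<Longrightarrow> Ck_on k S f \<Longrightarrow> Ck_on k T f \<Longrightarrow> Ck_on k (S \<union> T) f"
  by (induction k arbitrary: f) (auto intro: continuous_on_open_Un)

lemma Ck_on_const: "open S \<Longrightarrow> Ck_on k S (\<lambda>x. c)"
proof (induction k arbitrary: c)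
  case (Suc k)
  then show ?case by (auto intro!: Ck_on_SucI[where f' = "\<lambda>_ _. 0"])
qed auto

lemma Ck_on_bounded_linear:
  assumes "bounded_linear L" "open S" "Ck_on k S f"
  shows "Ck_on k S (\<lambda>x. L (f x))"
  using assms(3)
proof (induction k arbitrary: f)
  case 0
  then show ?case
    by (simp add: bounded_linear.continuous_on[OF assms(1)])
next
  case (Suc k)
  show ?case
    by (rule Ck_on_SucI[OF assms(2) bounded_linear.has_derivative[OF assms(1)
          Ck_on_SucD(1)[OF Suc.prems]]]) (auto intro: Suc.IH Ck_on_SucD(2)[OF Suc.prems])
qed

lemma Ck_on_add:
  assumes "open S" "Ck_on k S f" "Ck_on k S g"
  shows "Ck_on k S (\<lambda>x. f x + g x)"
  using assms(2,3)
proof (induction k arbitrary: f g)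
  case 0
  then show ?case by (simp add: continuous_on_add continuous_on_mult)
next
  case (Suc k)
  note f = Ck_on_SucD[OF Suc.prems(1)] and g = Ck_on_SucD[OF Suc.prems(2)]
  show ?case
    by (rule Ck_on_SucI[OF assms(1) has_derivative_add[OF f(1) g(1)]]) (auto intro: Suc.IH f g)
qed

lemma Ck_on_sum:
  assumes "open S" "\<And>i. i \<in> I \<Longrightarrow> Ck_on k S (f i)"
  shows "Ck_on k S (\<lambda>x. \<Sum>i\<in>I. f i x)"
  using assms(2)
proof (induction I rule: infinite_finite_induct)
  case (insert i I)
  then show ?case by (simp add: Ck_on_add[OF assms(1)])
qed (simp_all add: Ck_on_const assms(1))

lemma Ck_on_mult:
  fixes f g :: "'b::euclidean_space \<Rightarrow> real"
  assumes "open S" "Ck_on k S f" "Ck_on k S g"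
  shows "Ck_on k S (\<lambda>x. f x * g x)"
  using assms(2,3)
proof (induction k arbitrary: f g)
  case 0
  then show ?case by (simp add: continuous_on_add continuous_on_mult)
next
  case (Suc k)
  note f = Ck_on_SucD[OF Suc.prems(1)] and g = Ck_on_SucD[OF Suc.prems(2)]
  show ?case
    by (rule Ck_on_SucI[OF assms(1) has_derivative_mult[OF f(1) g(1)]])
      (auto intro!: Ck_on_add Suc.IH assms(1) f g Ck_on_pred[OF Suc.prems(1)]
        Ck_on_pred[OF Suc.prems(2)])
qed

lemma linear_euclidean_expand:
  fixes L :: "'c::euclidean_space \<Rightarrow> real"
  assumes "linear L"
  shows "L v = (\<Sum>c\<in>Basis. (v \<bullet> c) * L c)"
proof -
  have "L v = L (\<Sum>c\<in>Basis. (v \<bullet> c) *\<^sub>R c)" by (simp add: euclidean_representation)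
  also have "\<dots> = (\<Sum>c\<in>Basis. (v \<bullet> c) * L c)"
    using assms by (simp add: linear_sum linear_scale)
  finally show ?thesis .
qed

text \<open>The chain rule gives \<open>D(g \<circ> F)(x) v = Dg(F x)(DF(x) v)\<close>, in which the direction of \<open>Dg\<close> depends
on \<open>x\<close>, whereas \<^const>\<open>Ck_on\<close> controls derivatives in fixed directions only. Expanding in the
standard basis, \<open>D(g \<circ> F)(x) v = \<Sum>\<^sub>c (DF(x) v \<bullet> c) Dg(F x) c\<close>, turns this into a sum of products to
which the induction hypothesis applies.\<close>

lemma Ck_on_compose:
  fixes F :: "'b::euclidean_space \<Rightarrow> 'c::euclidean_space" and g :: "'c \<Rightarrow> real"
  assumes "open S" "F ` S \<subseteq> T" "Ck_on k S F" "Ck_on k T g"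
  shows "Ck_on k S (\<lambda>x. g (F x))"
  using assms(3,4)
proof (induction k arbitrary: g)
  case 0
  then show ?case
    using assms(2) by (auto intro: continuous_on_compose2)
next
  case (Suc k)
  note F = Ck_on_SucD[OF Suc.prems(1)] and g = Ck_on_SucD[OF Suc.prems(2)]
  let ?F' = "\<lambda>x. frechet_derivative F (at x)" and ?g' = "\<lambda>y. frechet_derivative g (at y)"
  show ?case
  proof (rule Ck_on_SucI[OF assms(1)])
    fix x assume x: "x \<in> S"
    have "((\<lambda>x. g (F x)) has_derivative (\<lambda>v. ?g' (F x) (?F' x v))) (at x)"
      using x assms(2) by (auto intro!: has_derivative_compose[OF F(1) g(1)])
    moreover have "linear (?g' (F x))"
      using g(1)[of "F x"] x assms(2) by (auto intro: has_derivative_linear)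
    ultimately show "((\<lambda>x. g (F x)) has_derivative
        (\<lambda>v. \<Sum>c\<in>Basis. (?F' x v \<bullet> c) * ?g' (F x) c)) (at x)"
      by (simp add: linear_euclidean_expand[symmetric])
  next
    fix v
    show "Ck_on k S (\<lambda>x. \<Sum>c\<in>Basis. (?F' x v \<bullet> c) * ?g' (F x) c)"
      by (intro Ck_on_sum Ck_on_mult assms(1) Suc.IH
            Ck_on_bounded_linear[OF bounded_linear_inner_left] Ck_on_pred[OF Suc.prems(1)] F g)
  qed
qed

section \<open>Bump functions and Hadamard's lemma\<close>

lemma Ck_on_imp_continuous_on: "Ck_on k S f \<Longrightarrow> continuous_on S f"
  by (cases k) (auto intro: differentiable_imp_continuous_on differentiable_at_imp_differentiable_on)

lemma Ck_on_affine: "open S \<Longrightarrow> Ck_on k S (\<lambda>x. (x - a) \<bullet> b)"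
proof (cases k)
  case (Suc l)
  assume "open S"
  then show ?thesis unfolding Suc
    by (rule Ck_on_SucI[where f' = "\<lambda>_ v. v \<bullet> b"])
      (auto intro!: derivative_eq_intros Ck_on_const \<open>open S\<close>)
qed (auto intro!: continuous_intros)

text \<open>The classical smooth function that vanishes for \<open>t \<le> 0\<close> is the case \<open>j = 0\<close>. The factor \<open>1 / t\<^sup>j\<close> makes
the family closed, up to linear combinations, under differentiation, so that smoothness of all its
members follows by one induction on the order of differentiability.\<close>

definition flat_exp :: "nat \<Rightarrow> real \<Rightarrow> real" where
  "flat_exp j t = (if t > 0 then exp (- 1 / t) / t ^ j else 0)"

lemma flat_exp_has_derivative:
  "(flat_exp j has_real_derivative flat_exp (j + 2) t - real j * flat_exp (j + 1) t) (at t)"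
proof (cases t "0 :: real" rule: linorder_cases)
  case less
  have "((\<lambda>_. 0) has_real_derivative 0) (at t)" by simp
  then have "(flat_exp j has_real_derivative 0) (at t)"
    by (rule has_field_derivative_transform_within_open[where S = "{..<0}"])
      (use less in \<open>auto simp: flat_exp_def\<close>)
  then show ?thesis using less by (simp add: flat_exp_def)
next
  case equal
  \<comment> \<open>The difference quotient of the function with index \<open>j\<close> at \<open>0\<close> is the function with index \<open>j + 1\<close>.\<close>
  have "((\<lambda>h. inverse h ^ (j + 1) / exp (inverse h)) \<longlongrightarrow> (0 :: real)) (at_right 0)"
    by (rule filterlim_compose[OF tendsto_power_div_exp_0 filterlim_inverse_at_top_right])
  then have "(flat_exp (j + 1) \<longlongrightarrow> 0) (at_right 0)"
    by (rule Lim_transform_eventually)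
      (auto simp: flat_exp_def eventually_at_right_field exp_minus field_simps intro!: exI[of _ 1])
  moreover have "(flat_exp (j + 1) \<longlongrightarrow> 0) (at_left 0)"
    by (rule tendsto_eventually) (auto simp: flat_exp_def eventually_at_left_field intro!: exI[of _ "-1"])
  ultimately have "(flat_exp (j + 1) \<longlongrightarrow> 0) (at 0)" by (simp add: filterlim_at_split)
  then have "((\<lambda>h. (flat_exp j (0 + h) - flat_exp j 0) / h) \<longlongrightarrow> 0) (at 0)"
    by (rule Lim_transform_eventually) (auto simp: flat_exp_def eventually_at_filter field_simps)
  then show ?thesis using equal by (simp add: DERIV_def flat_exp_def)
next
  case greater
  have "((\<lambda>t. exp (- 1 / t)) has_real_derivative exp (- 1 / t) / t\<^sup>2) (at t)"
    using greater by (auto intro!: derivative_eq_intros simp: field_simps power2_eq_square)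
  from DERIV_divide[OF this DERIV_pow[of j]] greater
  have "((\<lambda>t. exp (- 1 / t) / t ^ j) has_real_derivative
      (exp (- 1 / t) / t\<^sup>2 * t ^ j - exp (- 1 / t) * (real j * t ^ (j - Suc 0))) / (t ^ j * t ^ j)) (at t)"
    by simp
  also have "(exp (- 1 / t) / t\<^sup>2 * t ^ j - exp (- 1 / t) * (real j * t ^ (j - Suc 0))) / (t ^ j * t ^ j) =
      flat_exp (j + 2) t - real j * flat_exp (j + 1) t"
    using greater by (cases j) (simp_all add: flat_exp_def field_simps power2_eq_square)
  finally have "((\<lambda>t. exp (- 1 / t) / t ^ j) has_real_derivative
      flat_exp (j + 2) t - real j * flat_exp (j + 1) t) (at t)" .
  then show ?thesis
    by (rule has_field_derivative_transform_within_open[where S = "{0<..}"])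
      (use greater in \<open>auto simp: flat_exp_def\<close>)
qed

lemma Ck_on_flat_exp: "Ck_on k UNIV (flat_exp j)"
proof (induction k arbitrary: j)
  case 0
  show ?case
    using flat_exp_has_derivative[of j]
    by (auto intro!: continuous_at_imp_continuous_on DERIV_isCont)
next
  case (Suc k)
  show ?case
  proof (rule Ck_on_SucI)
    show "(flat_exp j has_derivative (\<lambda>v. (flat_exp (j + 2) t + (- real j) * flat_exp (j + 1) t) * v)) (at t)" for t
      using flat_exp_has_derivative[of j t] by (simp add: has_field_derivative_def)
    show "Ck_on k UNIV (\<lambda>t. (flat_exp (j + 2) t + (- real j) * flat_exp (j + 1) t) * v)" for v
      by (intro Ck_on_mult Ck_on_add Ck_on_const Suc.IH open_UNIV)
  qed auto
qed

text \<open>\<open>\<theta>(x) = h(r\<^sup>2 - |x - a|\<^sup>2) / h(r\<^sup>2)\<close> with \<open>h(t) = exp(-1/t)\<close> for \<open>t > 0\<close>. The value \<open>1\<close> at the centre is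
enough below: derivations at a point cannot see more of \<open>\<theta>\<close> when it multiplies a function that vanishes
there, so \<open>\<theta>\<close> need not be constant near \<open>a\<close>.\<close>

lemma smooth_bump:
  fixes a :: "'b::euclidean_space"
  assumes "r > 0"
  obtains \<theta> :: "'b \<Rightarrow> real"
  where "smooth_on UNIV \<theta>" "\<theta> a = 1" "\<And>x. x \<notin> ball a r \<Longrightarrow> \<theta> x = 0"
proof
  let ?q = "\<lambda>x. r\<^sup>2 + (\<Sum>b\<in>Basis. - 1 * (((x - a) \<bullet> b) * ((x - a) \<bullet> b)))"
  let ?\<theta> = "\<lambda>x. 1 / flat_exp 0 (r\<^sup>2) * flat_exp 0 (?q x)"
  have q: "?q x = r\<^sup>2 - (dist a x)\<^sup>2" for x
    using euclidean_inner[of "x - a" "x - a"]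
    by (simp add: sum_negf dist_norm norm_minus_commute[of a] power2_norm_eq_inner)
  have "Ck_on k UNIV ?q" for k
    by (intro Ck_on_add Ck_on_mult Ck_on_sum Ck_on_const Ck_on_affine open_UNIV)
  then have "Ck_on k UNIV (\<lambda>x. flat_exp 0 (?q x))" for k
    by (intro Ck_on_compose[OF _ _ _ Ck_on_flat_exp]) auto
  then show "smooth_on UNIV ?\<theta>"
    unfolding smooth_on_def by (intro allI Ck_on_mult Ck_on_const open_UNIV)
  show "?\<theta> a = 1" using assms by (simp add: flat_exp_def)
  show "?\<theta> x = 0" if "x \<notin> ball a r" for x
  proof -
    have "r\<^sup>2 \<le> (dist a x)\<^sup>2" using that assms by (intro power_mono) auto
    then show ?thesis unfolding q by (simp add: flat_exp_def)
  qed
qed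

text \<open>For \<open>j = 0\<close> these are the coefficients in Hadamard's lemma. The weight \<open>t\<^sup>j\<close> is there because each
differentiation in \<open>x\<close> under the integral sign produces a further factor \<open>t\<close>.\<close>

definition ray_average :: "'b::euclidean_space \<Rightarrow> nat \<Rightarrow> ('b \<Rightarrow> real) \<Rightarrow> 'b \<Rightarrow> real" where
  "ray_average a j G x = integral {0..1} (\<lambda>t. t ^ j * G (a + t *\<^sub>R (x - a)))"

lemma ray_in_ball:
  fixes a x :: "'b::euclidean_space"
  assumes "x \<in> ball a R" "t \<in> {0..1}"
  shows "a + t *\<^sub>R (x - a) \<in> ball a R"
proof -
  have "norm (t *\<^sub>R (x - a)) \<le> 1 * norm (x - a)"
    unfolding norm_scaleR using assms by (intro mult_right_mono) auto
  also have "\<dots> < R" using assms by (simp add: dist_norm norm_minus_commute)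
  finally show ?thesis by (simp add: dist_norm)
qed

lemma continuous_on_ray:
  fixes a :: "'b::euclidean_space" and G :: "'b \<Rightarrow> real"
  assumes "continuous_on (ball a R) G"
  shows "continuous_on (ball a R \<times> {0..1}) (\<lambda>(x, t). t ^ j * G (a + t *\<^sub>R (x - a)))"
proof -
  have "continuous_on (ball a R \<times> {0..1}) (\<lambda>p. G (a + snd p *\<^sub>R (fst p - a)))"
    by (rule continuous_on_compose2[OF assms])
      (auto intro!: continuous_intros ray_in_ball simp del: mem_ball)
  then show ?thesis unfolding case_prod_unfold by (intro continuous_intros)
qed

lemma ray_integrable:
  fixes a :: "'b::euclidean_space" and G :: "'b \<Rightarrow> real"
  assumes "continuous_on (ball a R) G" "x \<in> ball a R"
  shows "(\<lambda>t. t ^ j * G (a + t *\<^sub>R (x - a))) integrable_on {0..1}"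
proof (rule integrable_continuous_real)
  have "continuous_on {0..1} (Pair x)" "Pair x ` {0..1} \<subseteq> ball a R \<times> {0..1}"
    using assms(2) by (auto intro!: continuous_intros)
  from continuous_on_compose2[OF continuous_on_ray[OF assms(1), of j] this]
  show "continuous_on {0..1} (\<lambda>t. t ^ j * G (a + t *\<^sub>R (x - a)))" by simp
qed

text \<open>Differentiation under the integral sign. The Leibniz rule asks for a derivative that is continuous
in the operator norm; \<open>D\<close> below is assembled from the finitely many partial derivatives, which are
continuous, to meet this requirement.\<close>

lemma ray_average_has_derivative:
  fixes a :: "'b::euclidean_space" and G :: "'b \<Rightarrow> real"
  assumes G: "\<And>y. y \<in> ball a R \<Longrightarrow> (G has_derivative G' y) (at y)"
    and cont: "\<And>v. continuous_on (ball a R) (\<lambda>y. G' y v)"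
    and x: "x \<in> ball a R"
  shows "(ray_average a j G has_derivative
    (\<lambda>v. \<Sum>b\<in>Basis. (v \<bullet> b) * ray_average a (Suc j) (\<lambda>y. G' y b) x)) (at x)"
proof -
  define D :: "'b \<Rightarrow> real \<Rightarrow> 'b \<Rightarrow>\<^sub>L real" where
    "D x t = (\<Sum>b\<in>Basis. (t ^ Suc j * G' (a + t *\<^sub>R (x - a)) b) *\<^sub>R blinfun_inner_left b)" for x t
  have D: "blinfun_apply (D x t) v =
      (\<Sum>b\<in>Basis. (v \<bullet> b) * (t ^ Suc j * G' (a + t *\<^sub>R (x - a)) b))" for x t v
    by (simp add: D_def blinfun.sum_left blinfun.scaleR_left mult.commute)
  have contG: "continuous_on (ball a R) G"
    using G by (meson continuous_at_imp_continuous_on has_derivative_continuous)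
  have contD: "continuous_on (ball a R \<times> cbox 0 1) (\<lambda>(x, t). D x t)"
    unfolding D_def case_prod_unfold cbox_interval
    by (intro continuous_intros continuous_on_ray[OF cont, unfolded case_prod_unfold])
  have "((\<lambda>x. integral (cbox 0 1) (\<lambda>t. t ^ j * G (a + t *\<^sub>R (x - a)))) has_derivative
      blinfun_apply (integral (cbox 0 1) (D x))) (at x within ball a R)"
  proof (rule leibniz_rule[OF _ _ contD x convex_ball])
    fix x :: 'b and t :: real
    assume x: "x \<in> ball a R" and t: "t \<in> cbox 0 1"
    have y: "a + t *\<^sub>R (x - a) \<in> ball a R" using ray_in_ball[OF x, of t] t by simp
    have "((\<lambda>x. t ^ j * G (a + t *\<^sub>R (x - a))) has_derivative
        (\<lambda>v. t ^ j * G' (a + t *\<^sub>R (x - a)) (t *\<^sub>R v))) (at x)"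
      by (auto intro!: derivative_eq_intros has_derivative_compose[where f = "\<lambda>x. a + t *\<^sub>R (x - a)" and g = G, OF _ G[OF y]])
    moreover have "linear (G' (a + t *\<^sub>R (x - a)))"
      using G[OF y] by (rule has_derivative_linear)
    then have "t ^ j * G' (a + t *\<^sub>R (x - a)) (t *\<^sub>R v) = blinfun_apply (D x t) v" for v
      unfolding D linear_scale[OF \<open>linear _\<close>] linear_euclidean_expand[OF \<open>linear _\<close>, of v]
      by (simp add: sum_distrib_left mult_ac)
    ultimately show "((\<lambda>x. t ^ j * G (a + t *\<^sub>R (x - a))) has_derivative blinfun_apply (D x t))
        (at x within ball a R)"
      by (simp add: has_derivative_at_withinI)
  next
    fix x assume "x \<in> ball a R"
    then show "(\<lambda>t. t ^ j * G (a + t *\<^sub>R (x - a))) integrable_on cbox 0 1"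
      using ray_integrable[OF contG] by simp
  qed
  moreover have "at x within ball a R = at x"
    using x open_ball by (rule at_within_open)
  moreover have "blinfun_apply (integral (cbox 0 1) (D x)) =
      (\<lambda>v. \<Sum>b\<in>Basis. (v \<bullet> b) * ray_average a (Suc j) (\<lambda>y. G' y b) x)"
  proof
    fix v
    have "continuous_on (cbox 0 1) (Pair x)" "Pair x ` cbox 0 1 \<subseteq> ball a R \<times> cbox 0 1"
      using x by (auto intro!: continuous_intros)
    from continuous_on_compose2[OF contD this]
    have "D x integrable_on cbox 0 1" by (simp add: integrable_continuous_real)
    then have "blinfun_apply (integral (cbox 0 1) (D x)) v =
        integral {0..1} (\<lambda>t. \<Sum>b\<in>Basis. (v \<bullet> b) * (t ^ Suc j * G' (a + t *\<^sub>R (x - a)) b))"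
      by (simp add: blinfun_apply_integral D)
    also have "\<dots> = (\<Sum>b\<in>Basis. integral {0..1} (\<lambda>t. (v \<bullet> b) * (t ^ Suc j * G' (a + t *\<^sub>R (x - a)) b)))"
      by (intro integral_sum finite_Basis integrable_on_mult_right ray_integrable[OF cont x])
    finally show "blinfun_apply (integral (cbox 0 1) (D x)) v =
        (\<Sum>b\<in>Basis. (v \<bullet> b) * ray_average a (Suc j) (\<lambda>y. G' y b) x)"
      by (simp add: ray_average_def)
  qed
  ultimately show ?thesis by (simp add: ray_average_def[abs_def])
qed

lemma Ck_on_ray_average:
  fixes a :: "'b::euclidean_space" and G :: "'b \<Rightarrow> real"
  assumes "Ck_on k (ball a R) G"
  shows "Ck_on k (ball a R) (ray_average a j G)"
  using assms
proof (induction k arbitrary: j G)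
  case 0
  then show ?case
    using integral_continuous_on_param[of "ball a R" 0 1 "\<lambda>x t. t ^ j * G (a + t *\<^sub>R (x - a))"]
      continuous_on_ray[of a R G j]
    by (simp add: ray_average_def[abs_def])
next
  case (Suc k)
  note G = Ck_on_SucD[OF Suc.prems]
  show ?case
    by (rule Ck_on_SucI[OF open_ball ray_average_has_derivative[OF G(1)
          Ck_on_imp_continuous_on[OF G(2)]]])
      (assumption | intro Ck_on_sum Ck_on_mult Ck_on_const open_ball Suc.IH G(2))+
qed

text \<open>The fundamental theorem of calculus along the segment from \<open>a\<close> to \<open>x\<close>, with
\<open>DF(a + t (x - a)) (x - a)\<close> expanded in the standard basis.\<close>

lemma hadamard:
  fixes a :: "'b::euclidean_space" and F :: "'b \<Rightarrow> real"
  assumes "smooth_on (ball a R) F" "x \<in> ball a R"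
  shows "F x - F a =
    (\<Sum>b\<in>Basis. ((x - a) \<bullet> b) * ray_average a 0 (\<lambda>y. frechet_derivative F (at y) b) x)"
proof -
  let ?D = "\<lambda>y. frechet_derivative F (at y)"
  have "Ck_on (Suc 0) (ball a R) F" using assms(1) by (simp only: smooth_on_def)
  note F = Ck_on_SucD[OF this]
  have "((\<lambda>t. ?D (a + t *\<^sub>R (x - a)) (x - a)) has_integral
      F (a + 1 *\<^sub>R (x - a)) - F (a + 0 *\<^sub>R (x - a))) {0..1}"
  proof (rule fundamental_theorem_of_calculus)
    fix t :: real assume t: "t \<in> {0..1}"
    have "((\<lambda>t. F (a + t *\<^sub>R (x - a))) has_derivative
        (\<lambda>s. ?D (a + t *\<^sub>R (x - a)) (s *\<^sub>R (x - a)))) (at t)"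
      by (rule has_derivative_compose[where f = "\<lambda>t. a + t *\<^sub>R (x - a)" and g = F, OF _ F(1)[OF ray_in_ball[OF assms(2) t]]])
        (auto intro!: derivative_eq_intros)
    moreover have "linear (?D (a + t *\<^sub>R (x - a)))"
      using F(1)[OF ray_in_ball[OF assms(2) t]] by (rule has_derivative_linear)
    ultimately show "((\<lambda>t. F (a + t *\<^sub>R (x - a))) has_vector_derivative
        ?D (a + t *\<^sub>R (x - a)) (x - a)) (at t within {0..1})"
      unfolding has_vector_derivative_def
      by (simp add: linear_scale has_derivative_at_withinI)
  qed simp
  then have "F x - F a = integral {0..1} (\<lambda>t. ?D (a + t *\<^sub>R (x - a)) (x - a))"
    by (simp add: integral_unique)
  also have "\<dots> = integral {0..1}
      (\<lambda>t. \<Sum>b\<in>Basis. ((x - a) \<bullet> b) * (t ^ 0 * ?D (a + t *\<^sub>R (x - a)) b))"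
  proof (rule integral_cong)
    fix t :: real assume "t \<in> {0..1}"
    then have "linear (?D (a + t *\<^sub>R (x - a)))"
      using F(1) ray_in_ball[OF assms(2)] has_derivative_linear by blast
    then show "?D (a + t *\<^sub>R (x - a)) (x - a) =
        (\<Sum>b\<in>Basis. ((x - a) \<bullet> b) * (t ^ 0 * ?D (a + t *\<^sub>R (x - a)) b))"
      by (subst linear_euclidean_expand) auto
  qed
  also have "\<dots> = (\<Sum>b\<in>Basis. integral {0..1}
      (\<lambda>t. ((x - a) \<bullet> b) * (t ^ 0 * ?D (a + t *\<^sub>R (x - a)) b)))"
    by (intro integral_sum finite_Basis integrable_on_mult_right
        ray_integrable[OF Ck_on_imp_continuous_on[OF F(2)] assms(2)])
  finally show ?thesis by (simp add: ray_average_def)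
qed

lemma ray_average_at: "ray_average a 0 G a = G a"
  by (simp add: ray_average_def)

section \<open>Multilinear and alternating forms\<close>

lemma linear_onD:
  assumes "linear_on V F" "subspace V"
  shows linear_on_add: "u \<in> V \<Longrightarrow> v \<in> V \<Longrightarrow> F (u + v) = F u + F v"
    and linear_on_scale: "u \<in> V \<Longrightarrow> F (c *\<^sub>R u) = c *\<^sub>R F u"
proof -
  assume uv: "u \<in> V" "v \<in> V"
  then have "F (1 *\<^sub>R u + 1 *\<^sub>R v) = 1 *\<^sub>R F u + 1 *\<^sub>R F v"
    using assms unfolding linear_on_def by blast
  then show "F (u + v) = F u + F v" by simp
next
  assume u: "u \<in> V"
  then have "F (c *\<^sub>R u + 0 *\<^sub>R u) = c *\<^sub>R F u + 0 *\<^sub>R F u"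
    using assms unfolding linear_on_def by blast
  then show "F (c *\<^sub>R u) = c *\<^sub>R F u" by simp
qed

lemma linear_onI:
  assumes "\<And>u v. u \<in> V \<Longrightarrow> v \<in> V \<Longrightarrow> F (u + v) = F u + F v"
    and "\<And>c u. u \<in> V \<Longrightarrow> F (c *\<^sub>R u) = c *\<^sub>R F u" and "subspace V"
  shows "linear_on V F"
  unfolding linear_on_def using assms by (simp add: subspace_scale)

lemma linear_on_sum:
  assumes "linear_on V F" "subspace V" "\<And>i. i \<in> I \<Longrightarrow> x i \<in> V"
  shows "F (\<Sum>i\<in>I. x i) = (\<Sum>i\<in>I. F (x i))"
proof -
  have "F 0 = 0"
    using linear_on_scale[OF assms(1,2) subspace_0[OF assms(2)], of 0] by simp
  then show ?thesis
    using assms(3)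
  proof (induction I rule: infinite_finite_induct)
    case (insert i I)
    then show ?case
      by (simp add: linear_on_add[OF assms(1,2)] subspace_sum[OF assms(2)])
  qed simp_all
qed

lemma sum_lists_Suc:
  "(\<Sum>js\<in>{js. length js = Suc k \<and> set js \<subseteq> I}. f js) =
   (\<Sum>j\<in>I. \<Sum>js\<in>{js. length js = k \<and> set js \<subseteq> I}. f (j # js))"
proof -
  have "{js. length js = Suc k \<and> set js \<subseteq> I} =
      (\<lambda>(j, js). j # js) ` (I \<times> {js. length js = k \<and> set js \<subseteq> I})"
    by (auto simp: length_Suc_conv image_iff)
  then show ?thesis
    by (simp add: sum.reindex inj_on_def case_prod_unfold sum.cartesian_product)
qed

lemma multilinear_on_Cons:
  assumes "multilinear_on (Suc k) V F" "x \<in> V"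
  shows "multilinear_on k V (\<lambda>xs. F (x # xs))"
  unfolding multilinear_on_def
proof (intro allI impI)
  fix xs i assume xs: "length xs = k \<and> set xs \<subseteq> V \<and> i < k"
  then have "linear_on V (\<lambda>v. F ((x # xs)[Suc i := v]))"
    using assms unfolding multilinear_on_def by (metis Suc_less_eq insert_subset length_Cons list.simps(15))
  then show "linear_on V (\<lambda>v. F (x # xs[i := v]))" by simp
qed

lemma multilinear_on_expand:
  assumes "subspace V" "multilinear_on k V F" "length xs = k"
    and "\<And>j. j \<in> I \<Longrightarrow> u j \<in> V"
    and "\<And>x. x \<in> set xs \<Longrightarrow> x = (\<Sum>j\<in>I. c x j *\<^sub>R u j)"
  shows "F xs = (\<Sum>js | length js = k \<and> set js \<subseteq> I. (\<Prod>i<k. c (xs ! i) (js ! i)) * F (map u js))"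
  using assms(2,3,5)
proof (induction k arbitrary: F xs)
  case 0
  have "{js :: 'b list. js = [] \<and> set js \<subseteq> I} = {[]}" by auto
  then show ?case using 0 by simp
next
  case (Suc k)
  then obtain x ys where xs: "xs = x # ys" "length ys = k" by (cases xs) auto
  have sub: "set ys \<subseteq> V"
  proof
    fix y assume "y \<in> set ys"
    then have "y = (\<Sum>j\<in>I. c y j *\<^sub>R u j)" using Suc.prems(3) xs by simp
    also have "\<dots> \<in> V" using assms(1,4) by (intro subspace_sum subspace_scale)
    finally show "y \<in> V" .
  qed
  have "linear_on V (\<lambda>v. F ((0 # ys)[0 := v]))"
    using Suc.prems(1) sub xs(2) subspace_0[OF assms(1)] unfolding multilinear_on_def
    by (metis insert_subset length_Cons list.simps(15) zero_less_Suc)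
  then have lin: "linear_on V (\<lambda>v. F (v # ys))" by simp
  have "F xs = F ((\<Sum>j\<in>I. c x j *\<^sub>R u j) # ys)"
    using Suc.prems(3)[of x] xs by simp
  also have "\<dots> = (\<Sum>j\<in>I. c x j * F (u j # ys))"
    using assms(1,4) by (simp add: linear_on_sum[OF lin] linear_on_scale[OF lin] subspace_scale)
  also have "\<dots> = (\<Sum>j\<in>I. c x j * (\<Sum>js | length js = k \<and> set js \<subseteq> I.
      (\<Prod>i<k. c (ys ! i) (js ! i)) * F (u j # map u js)))"
  proof (rule sum.cong[OF refl])
    fix j assume "j \<in> I"
    then show "c x j * F (u j # ys) = c x j * (\<Sum>js | length js = k \<and> set js \<subseteq> I.
      (\<Prod>i<k. c (ys ! i) (js ! i)) * F (u j # map u js))"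
      using Suc.IH[OF multilinear_on_Cons[OF Suc.prems(1) assms(4)] xs(2)] Suc.prems(3) xs(1) by simp
  qed
  also have "\<dots> = (\<Sum>js | length js = Suc k \<and> set js \<subseteq> I.
      (\<Prod>i<Suc k. c (xs ! i) (js ! i)) * F (map u js))"
    unfolding sum_lists_Suc xs(1) prod.lessThan_Suc_shift
    by (simp add: sum_distrib_left mult_ac)
  finally show ?case .
qed

lemma permute_list_transpose:
  assumes "i < length xs" "j < length xs"
  shows "permute_list (Transposition.transpose i j) xs = xs[i := xs ! j, j := xs ! i]"
  using assms by (intro nth_equalityI) (auto simp: permute_list_nth permutes_swap_id nth_list_update Transposition.transpose_def)

lemma skew_symmetric_on_swap:
  assumes "skew_symmetric_on k V F" "length xs = k" "set xs \<subseteq> V" "i < k" "j < k" "i \<noteq> j"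
  shows "F (xs[i := xs ! j, j := xs ! i]) = - F xs"
proof (cases "i < j")
  case False
  then have "F (xs[j := xs ! i, i := xs ! j]) = - F xs"
    using assms unfolding skew_symmetric_on_def by (metis nat_neq_iff)
  then show ?thesis using assms(6) by (simp add: list_update_swap)
qed (use assms in \<open>auto simp: skew_symmetric_on_def\<close>)

text \<open>\<^const>\<open>skew_symmetric_on\<close> is about a single transposition; the transpositions generate the symmetric
group, and the sign is multiplicative.\<close>

lemma skew_symmetric_on_permute:
  assumes "skew_symmetric_on k V F" "p permutes {..<k}" "length xs = k" "set xs \<subseteq> V"
  shows "F (permute_list p xs) = of_int (sign p) * F xs"
  using finite_lessThan assms(2)
proof (induction rule: permutes_rev_induct)
  case id
  then show ?case by (simp add: permute_list_id)
next
  case (swap a b p)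
  let ?t = "Transposition.transpose a b"
  have t: "?t permutes {..<k}" using swap by (simp add: permutes_swap_id)
  have p: "set (permute_list p xs) \<subseteq> V" "length (permute_list p xs) = k"
    using assms(3,4) swap by (simp_all add: set_permute_list)
  have "permute_list (p \<circ> ?t) xs = permute_list ?t (permute_list p xs)"
    using t assms(3) by (simp add: permute_list_compose)
  then have "F (permute_list (p \<circ> ?t) xs) = - F (permute_list p xs)"
    using skew_symmetric_on_swap[OF assms(1) p(2,1)] swap p(2) by (simp add: permute_list_transpose)
  moreover have "sign (p \<circ> ?t) = - sign p"
    using swap t
    by (subst sign_compose) (auto simp: sign_swap_id permutation_permutes[of p] permutation_swap_id
        intro: permutes_imp_permutation)
  ultimately show ?case using swap by (simp add: o_def)
qed

lemma wedge_permute: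
  assumes "p permutes {..<length \<alpha>s}" "length vs = length \<alpha>s" "set vs \<subseteq> V"
  shows "wedge V \<alpha>s (permute_list p vs) = of_int (sign p) * wedge V \<alpha>s vs"
proof -
  let ?k = "length \<alpha>s"
  let ?f = "\<lambda>q. of_int (sign q) * (\<Prod>i<?k. (\<alpha>s ! i) (vs ! q i)) :: real"
  have fin: "finite {..<?k}" by simp
  have "of_int (sign q) * (\<Prod>i<?k. (\<alpha>s ! i) (permute_list p vs ! q i)) =
      of_int (sign p) * ?f (p \<circ> q)" if q: "q permutes {..<?k}" for q
  proof -
    have "permute_list p vs ! q i = vs ! (p \<circ> q) i" if "i < ?k" for i
      using assms permutes_in_image[OF q, of i] that by (simp add: permute_list_nth)
    moreover have "sign q = sign p * sign (p \<circ> q)"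
      by (simp add: sign_compose permutes_imp_permutation[OF fin q]
          permutes_imp_permutation[OF fin assms(1)] mult.assoc[symmetric])
    ultimately show ?thesis by simp
  qed
  then have "wedge V \<alpha>s (permute_list p vs) =
      (\<Sum>q | q permutes {..<?k}. of_int (sign p) * ?f (p \<circ> q))"
    using assms unfolding wedge_def by (simp add: set_permute_list)
  also have "\<dots> = of_int (sign p) * (\<Sum>q | q permutes {..<?k}. ?f (p \<circ> q))"
    by (simp add: sum_distrib_left)
  also have "(\<Sum>q | q permutes {..<?k}. ?f (p \<circ> q)) = (\<Sum>q | q permutes {..<?k}. ?f q)"
    using setum_permutations_compose_left[OF assms(1), of ?f] by simp
  finally show ?thesis using assms(2,3) unfolding wedge_def by simp
qed

text \<open>In each term of the determinant, the \<open>i\<close>-th argument occurs in exactly one factor, the one with index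
\<open>inv p i\<close>; \<open>C p\<close> collects the others.\<close>

lemma wedge_in_alt_forms:
  assumes "subspace V" "\<And>\<alpha>. \<alpha> \<in> set \<alpha>s \<Longrightarrow> linear_on V \<alpha>" "length \<alpha>s = k"
  shows "wedge V \<alpha>s \<in> alt_forms k V"
  unfolding alt_forms_def mem_Collect_eq
proof (intro conjI)
  show "multilinear_on k V (wedge V \<alpha>s)"
    unfolding multilinear_on_def
  proof (intro allI impI)
    fix xs i assume xs: "length xs = k \<and> set xs \<subseteq> V \<and> i < k"
    define C where "C p = of_int (sign p) * (\<Prod>l\<in>{..<k} - {inv p i}. (\<alpha>s ! l) (xs ! p l))" for p
    have *: "wedge V \<alpha>s (xs[i := v]) = (\<Sum>p | p permutes {..<k}. C p * (\<alpha>s ! inv p i) v)"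
      if v: "v \<in> V" for v
    proof -
      have "set (xs[i := v]) \<subseteq> V" using xs v by (meson set_update_subsetI)
      moreover have "(\<Prod>l<k. (\<alpha>s ! l) (xs[i := v] ! p l)) =
          (\<alpha>s ! inv p i) v * (\<Prod>l\<in>{..<k} - {inv p i}. (\<alpha>s ! l) (xs ! p l))"
        if p: "p permutes {..<k}" for p
      proof -
        have "inv p i < k" using xs permutes_in_image[OF permutes_inv[OF p], of i] by simp
        then have "(\<Prod>l<k. (\<alpha>s ! l) (xs[i := v] ! p l)) =
            (\<alpha>s ! inv p i) (xs[i := v] ! p (inv p i)) *
            (\<Prod>l\<in>{..<k} - {inv p i}. (\<alpha>s ! l) (xs[i := v] ! p l))"
          by (intro prod.remove) auto
        moreover have "xs[i := v] ! p l = xs ! p l" if "l \<noteq> inv p i" for l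
          using that permutes_inverses[OF p] by (metis nth_list_update_neq)
        ultimately show ?thesis using xs permutes_inverses[OF p] by simp
      qed
      ultimately show ?thesis
        using xs assms(3) unfolding wedge_def C_def by (simp add: mult_ac)
    qed
    have lin: "linear_on V (\<alpha>s ! inv p i)" if "p permutes {..<k}" for p
      using xs permutes_in_image[OF permutes_inv[OF that], of i] assms(2,3) by simp
    show "linear_on V (\<lambda>v. wedge V \<alpha>s (xs[i := v]))"
      by (rule linear_onI[OF _ _ assms(1)])
        (simp_all add: * assms(1) subspace_add subspace_scale linear_on_add[OF lin] linear_on_scale[OF lin]
          algebra_simps sum.distrib sum_distrib_left)
  qed
  show "skew_symmetric_on k V (wedge V \<alpha>s)"
    unfolding skew_symmetric_on_def
  proof (intro allI impI)
    fix xs i j assume xs: "length xs = k \<and> set xs \<subseteq> V \<and> i < j \<and> j < k"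
    then show "wedge V \<alpha>s (xs[i := xs ! j, j := xs ! i]) = - wedge V \<alpha>s xs"
      using wedge_permute[of "Transposition.transpose i j" \<alpha>s xs V] assms(3)
      by (simp add: permute_list_transpose permutes_swap_id sign_swap_id)
  qed
  show "\<forall>vs. \<not> (length vs = k \<and> set vs \<subseteq> V) \<longrightarrow> wedge V \<alpha>s vs = 0"
    using assms(3) by (auto simp: wedge_def)
qed

lemma fun_sum_apply: "(\<Sum>i\<in>I. f i) x = (\<Sum>i\<in>I. f i x)"
  by (induction I rule: infinite_finite_induct) auto

lemma subspace_dual_space: "subspace V \<Longrightarrow> subspace (dual_space V)"
  by (rule subspaceI)
    (auto simp: dual_space_def linear_on_def algebra_simps)

lemma subspace_alt_forms: "subspace (alt_forms k V)"
proof (rule subspaceI)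
  fix \<omega> \<eta> :: "'a list \<Rightarrow> real" and c :: real
  assume w: "\<omega> \<in> alt_forms k V"
  show "c *\<^sub>R \<omega> \<in> alt_forms k V"
    using w by (simp add: alt_forms_def multilinear_on_def linear_on_def skew_symmetric_on_def algebra_simps)
  assume "\<eta> \<in> alt_forms k V"
  then show "\<omega> + \<eta> \<in> alt_forms k V"
    using w by (simp add: alt_forms_def multilinear_on_def linear_on_def skew_symmetric_on_def algebra_simps)
qed (simp add: alt_forms_def multilinear_on_def linear_on_def skew_symmetric_on_def)

lemma alt_formsD:
  assumes "\<omega> \<in> alt_forms k V"
  shows alt_forms_multilinear: "multilinear_on k V \<omega>"
    and alt_forms_skew: "skew_symmetric_on k V \<omega>"
    and alt_forms_outside: "\<not> (length vs = k \<and> set vs \<subseteq> V) \<Longrightarrow> \<omega> vs = 0"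
  using assms by (auto simp: alt_forms_def)

lemma multilinear_on_snoc:
  assumes "multilinear_on (Suc k) V F" "x \<in> V"
  shows "multilinear_on k V (\<lambda>xs. F (xs @ [x]))"
  unfolding multilinear_on_def
proof (intro allI impI)
  fix xs i assume xs: "length xs = k \<and> set xs \<subseteq> V \<and> i < k"
  then have "linear_on V (\<lambda>v. F ((xs @ [x])[i := v]))"
    using assms by (auto simp: multilinear_on_def)
  then show "linear_on V (\<lambda>v. F (xs[i := v] @ [x]))"
    using xs by (simp add: list_update_append1)
qed

lemma skew_symmetric_on_snoc:
  assumes "skew_symmetric_on (Suc k) V F" "x \<in> V"
  shows "skew_symmetric_on k V (\<lambda>xs. F (xs @ [x]))"
  unfolding skew_symmetric_on_def
proof (intro allI impI)
  fix xs i j assume xs: "length xs = k \<and> set xs \<subseteq> V \<and> i < j \<and> j < k"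
  then have "F ((xs @ [x])[i := (xs @ [x]) ! j, j := (xs @ [x]) ! i]) = - F (xs @ [x])"
    using assms unfolding skew_symmetric_on_def by simp
  then show "F (xs[i := xs ! j, j := xs ! i] @ [x]) = - F (xs @ [x])"
    using xs by (simp add: list_update_append1 nth_append)
qed

lemma linear_on_last:
  assumes "multilinear_on (Suc k) V F" "length xs = k" "set xs \<subseteq> V" "0 \<in> V"
  shows "linear_on V (\<lambda>v. F (xs @ [v]))"
proof -
  have "linear_on V (\<lambda>v. F ((xs @ [0])[k := v]))"
    using assms by (auto simp: multilinear_on_def)
  then show ?thesis unfolding assms(2)[symmetric] by simp
qed

section \<open>Frames and the map \<open>P\<^sup>\<sharp>\<close>\<close>

text \<open>The property that singles out \<open>P\<^sup>\<sharp>\<close> in the definition of \<^const>\<open>sharp\<close>.\<close>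

definition is_sharp :: "nat \<Rightarrow> 'v::real_vector set \<Rightarrow> (('v \<Rightarrow> real) list \<Rightarrow> real) \<Rightarrow>
    (('v list \<Rightarrow> real) \<Rightarrow> 'v) \<Rightarrow> bool" where
  "is_sharp n V P L \<longleftrightarrow>
     linear_on (alt_forms (n - 1) V) L \<and>
     (\<forall>\<omega>\<in>alt_forms (n - 1) V. L \<omega> \<in> V) \<and>
     (\<forall>\<omega>. \<omega> \<notin> alt_forms (n - 1) V \<longrightarrow> L \<omega> = 0) \<and>
     (\<forall>\<alpha>s \<beta>. length \<alpha>s = n - 1 \<and> set \<alpha>s \<subseteq> dual_space V \<and> \<beta> \<in> dual_space V \<longrightarrow>
        \<beta> (L (wedge V \<alpha>s)) = P (\<alpha>s @ [\<beta>]))"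

lemma sharp_eq_The: "sharp n V P = The (is_sharp n V P)"
  by (simp add: sharp_def is_sharp_def[abs_def])

text \<open>A basis with its dual basis, except that linear independence is not demanded. The formulas for
coordinates remain valid, and in this form the coordinate derivations of a chart can be used
directly.\<close>

locale finite_frame =
  fixes V :: "'v::real_vector set" and I :: "'i set"
    and u :: "'i \<Rightarrow> 'v" and e :: "'i \<Rightarrow> 'v \<Rightarrow> real"
  assumes subspace: "subspace V"
    and finite: "finite I"
    and u: "j \<in> I \<Longrightarrow> u j \<in> V"
    and e: "j \<in> I \<Longrightarrow> e j \<in> dual_space V"
    and expand: "v \<in> V \<Longrightarrow> v = (\<Sum>j\<in>I. e j v *\<^sub>R u j)"
begin

lemma dual_expand:
  assumes "\<alpha> \<in> dual_space V"
  shows "\<alpha> = (\<Sum>j\<in>I. \<alpha> (u j) *\<^sub>R e j)"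
proof
  fix v
  have lin: "linear_on V \<alpha>" using assms by (simp add: dual_space_def)
  show "\<alpha> v = (\<Sum>j\<in>I. \<alpha> (u j) *\<^sub>R e j) v"
  proof (cases "v \<in> V")
    case True
    have "\<alpha> v = \<alpha> (\<Sum>j\<in>I. e j v *\<^sub>R u j)" using expand[OF True] by simp
    also have "\<dots> = (\<Sum>j\<in>I. e j v * \<alpha> (u j))"
      using u by (simp add: linear_on_sum[OF lin subspace] linear_on_scale[OF lin subspace]
          subspace_scale[OF subspace])
    finally show ?thesis by (simp add: fun_sum_apply mult.commute)
  next
    case False
    then show ?thesis using assms e by (simp add: fun_sum_apply dual_space_def)
  qed
qed

lemma dual_separates:
  assumes "v \<in> V" "w \<in> V" "\<And>\<beta>. \<beta> \<in> dual_space V \<Longrightarrow> \<beta> v = \<beta> w"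
  shows "v = w"
  using expand[OF assms(1)] expand[OF assms(2)] assms(3)[OF e] by simp

lemma wedge_dual: "set \<alpha>s \<subseteq> dual_space V \<Longrightarrow> length \<alpha>s = k \<Longrightarrow> wedge V \<alpha>s \<in> alt_forms k V"
  by (rule wedge_in_alt_forms[OF subspace]) (auto simp: dual_space_def)

lemma map_e: "set js \<subseteq> I \<Longrightarrow> set (map e js) \<subseteq> dual_space V"
  using e by auto

text \<open>Summing over all words \<open>js\<close> of indices, and not just the increasing ones, avoids any order on the index
set and counts every term of the usual expansion \<open>k!\<close> times: for each permutation \<open>p\<close> in
\<open>wedge V (map e js) vs\<close>, the sum over \<open>js\<close> is the multilinear expansion of
\<open>\<omega> (permute_list p vs) = sign p \<cdot> \<omega> vs\<close>, whence every \<open>p\<close> contributes \<open>\<omega> vs\<close>.\<close>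

lemma alt_form_expand:
  assumes "\<omega> \<in> alt_forms k V"
  shows "\<omega> = (1 / fact k) *\<^sub>R
    (\<Sum>js | length js = k \<and> set js \<subseteq> I. \<omega> (map u js) *\<^sub>R wedge V (map e js))"
proof
  fix vs
  let ?W = "{js. length js = k \<and> set js \<subseteq> I}" and ?Pm = "{p. p permutes {..<k}}"
  have "(\<Sum>js\<in>?W. \<omega> (map u js) * wedge V (map e js) vs) = fact k * \<omega> vs"
  proof (cases "length vs = k \<and> set vs \<subseteq> V")
    case True
    have *: "(\<Sum>js\<in>?W. (\<Prod>i<k. e (js ! i) (vs ! p i)) * \<omega> (map u js)) = of_int (sign p) * \<omega> vs"
      if p: "p permutes {..<k}" for p
    proof -
      have perm: "set (permute_list p vs) \<subseteq> V" using True p by (simp add: set_permute_list)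
      have "of_int (sign p) * \<omega> vs = \<omega> (permute_list p vs)"
        using skew_symmetric_on_permute[OF alt_forms_skew[OF assms] p] True by simp
      also have "\<dots> = (\<Sum>js\<in>?W. (\<Prod>i<k. e (js ! i) (permute_list p vs ! i)) * \<omega> (map u js))"
        using True perm expand
        by (intro multilinear_on_expand[OF subspace alt_forms_multilinear[OF assms], where c = "\<lambda>v j. e j v"])
          (auto simp: u)
      also have "\<dots> = (\<Sum>js\<in>?W. (\<Prod>i<k. e (js ! i) (vs ! p i)) * \<omega> (map u js))"
        using True p by (simp add: permute_list_nth)
      finally show ?thesis by simp
    qed
    have "(\<Sum>js\<in>?W. \<omega> (map u js) * wedge V (map e js) vs) =
        (\<Sum>js\<in>?W. \<Sum>p\<in>?Pm. of_int (sign p) * ((\<Prod>i<k. e (js ! i) (vs ! p i)) * \<omega> (map u js)))"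
      using True by (intro sum.cong) (auto simp: wedge_def sum_distrib_left mult_ac)
    also have "\<dots> = (\<Sum>p\<in>?Pm. of_int (sign p) *
        (\<Sum>js\<in>?W. (\<Prod>i<k. e (js ! i) (vs ! p i)) * \<omega> (map u js)))"
      unfolding sum_distrib_left by (rule sum.swap)
    also have "\<dots> = (\<Sum>p\<in>?Pm. \<omega> vs)"
      by (intro sum.cong refl) (simp add: * mult.assoc[symmetric] flip: of_int_mult)
    also have "\<dots> = fact k * \<omega> vs"
      using card_permutations[of "{..<k}" k] by simp
    finally show ?thesis .
  next
    case False
    then show ?thesis
      using alt_forms_outside[OF assms False]
        alt_forms_outside[OF wedge_dual[OF map_e] False] by simp
  qed
  then show "\<omega> vs = ((1 / fact k) *\<^sub>R (\<Sum>js\<in>?W. \<omega> (map u js) *\<^sub>R wedge V (map e js))) vs"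
    by (simp add: fun_sum_apply)
qed

lemma linear_alt_form_expand:
  assumes lin: "linear_on (alt_forms k V) M" and \<omega>: "\<omega> \<in> alt_forms k V"
  shows "M \<omega> = (1 / fact k) *\<^sub>R
    (\<Sum>js | length js = k \<and> set js \<subseteq> I. \<omega> (map u js) *\<^sub>R M (wedge V (map e js)))"
proof -
  let ?W = "{js. length js = k \<and> set js \<subseteq> I}"
  let ?S = "\<Sum>js\<in>?W. \<omega> (map u js) *\<^sub>R wedge V (map e js)"
  note A = subspace_alt_forms[of k V]
  have mem: "wedge V (map e js) \<in> alt_forms k V" if "js \<in> ?W" for js
    using that map_e by (intro wedge_dual) auto
  then have "?S \<in> alt_forms k V" by (intro subspace_sum[OF A] subspace_scale[OF A])
  then have "M ((1 / fact k) *\<^sub>R ?S) = (1 / fact k) *\<^sub>R M ?S" by (rule linear_on_scale[OF lin A])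
  moreover have "M ?S = (\<Sum>js\<in>?W. M (\<omega> (map u js) *\<^sub>R wedge V (map e js)))"
    using mem by (intro linear_on_sum[OF lin A] subspace_scale[OF A])
  moreover have "\<dots> = (\<Sum>js\<in>?W. \<omega> (map u js) *\<^sub>R M (wedge V (map e js)))"
    using mem by (intro sum.cong refl linear_on_scale[OF lin A])
  ultimately show ?thesis using alt_form_expand[OF \<omega>] by simp
qed

text \<open>The dual computation: the alternating form \<open>F\<close> on the dual space is expanded, and for each
permutation \<open>p\<close> of the determinant the words \<open>js\<close> are reindexed by \<open>p\<close>.\<close>

lemma sum_wedge_pairing:
  assumes F: "multilinear_on k (dual_space V) F" "skew_symmetric_on k (dual_space V) F"
    and \<alpha>s: "length \<alpha>s = k" "set \<alpha>s \<subseteq> dual_space V"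
  shows "(\<Sum>js | length js = k \<and> set js \<subseteq> I. wedge V \<alpha>s (map u js) * F (map e js)) = fact k * F \<alpha>s"
proof -
  let ?W = "{js. length js = k \<and> set js \<subseteq> I}" and ?Pm = "{p. p permutes {..<k}}"
  let ?t = "\<lambda>js. (\<Prod>i<k. (\<alpha>s ! i) (u (js ! i))) * F (map e js)"
  have *: "(\<Sum>js\<in>?W. of_int (sign p) * ((\<Prod>i<k. (\<alpha>s ! i) (u (js ! p i))) * F (map e js))) = F \<alpha>s"
    if p: "p permutes {..<k}" for p
  proof -
    have "of_int (sign p) * ((\<Prod>i<k. (\<alpha>s ! i) (u (js ! p i))) * F (map e js)) = ?t (permute_list p js)"
      if "js \<in> ?W" for js
    proof -
      have "F (permute_list p (map e js)) = of_int (sign p) * F (map e js)"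
        using that map_e by (intro skew_symmetric_on_permute[OF F(2) p]) auto
      then have "F (map e (permute_list p js)) = of_int (sign p) * F (map e js)"
        using that p by (simp add: permute_list_map)
      then show ?thesis using that p by (simp add: permute_list_nth)
    qed
    then have "(\<Sum>js\<in>?W. of_int (sign p) * ((\<Prod>i<k. (\<alpha>s ! i) (u (js ! p i))) * F (map e js))) =
        (\<Sum>js\<in>?W. ?t (permute_list p js))"
      by (intro sum.cong) auto
    also have "\<dots> = (\<Sum>js\<in>?W. ?t js)"
    proof (rule sum.reindex_bij_witness[where i = "permute_list (inv p)" and j = "permute_list p"])
      fix js assume js: "js \<in> ?W"
      have "permute_list (inv p) (permute_list p js) = permute_list (p \<circ> inv p) js"
        using js permutes_inv[OF p] by (simp add: permute_list_compose)
      then show "permute_list (inv p) (permute_list p js) = js"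
        using permutes_inv_o[OF p] by (simp add: permute_list_id)
      have "permute_list p (permute_list (inv p) js) = permute_list (inv p \<circ> p) js"
        using js p by (simp add: permute_list_compose)
      then show "permute_list p (permute_list (inv p) js) = js"
        using permutes_inv_o[OF p] by (simp add: permute_list_id)
      show "permute_list p js \<in> ?W" "permute_list (inv p) js \<in> ?W"
        using js p permutes_inv[OF p] by (simp_all add: set_permute_list)
    qed simp
    also have "\<dots> = F \<alpha>s"
      using dual_expand \<alpha>s
      by (intro multilinear_on_expand[OF subspace_dual_space[OF subspace] F(1), symmetric,
            where c = "\<lambda>\<alpha> j. \<alpha> (u j)"]) (auto simp: e)
    finally show ?thesis .
  qed
  have "(\<Sum>js\<in>?W. wedge V \<alpha>s (map u js) * F (map e js)) =
      (\<Sum>js\<in>?W. \<Sum>p\<in>?Pm. of_int (sign p) * ((\<Prod>i<k. (\<alpha>s ! i) (u (js ! p i))) * F (map e js)))"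
  proof (intro sum.cong refl)
    fix js assume js: "js \<in> ?W"
    have "js ! p i \<in> I \<and> map u js ! p i = u (js ! p i)" if "p permutes {..<k}" "i < k" for p i
      using that js permutes_in_image[OF that(1), of i] nth_mem[of "p i" js] by auto
    then have "(\<Prod>i<k. (\<alpha>s ! i) (map u js ! p i)) = (\<Prod>i<k. (\<alpha>s ! i) (u (js ! p i)))"
      if "p permutes {..<k}" for p
      using that by (intro prod.cong) auto
    moreover have "set (map u js) \<subseteq> V" using js u by auto
    ultimately show "wedge V \<alpha>s (map u js) * F (map e js) =
        (\<Sum>p\<in>?Pm. of_int (sign p) * ((\<Prod>i<k. (\<alpha>s ! i) (u (js ! p i))) * F (map e js)))"
      using js \<alpha>s(1) by (simp add: wedge_def sum_distrib_right mult.assoc del: set_map)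
  qed
  also have "\<dots> = (\<Sum>p\<in>?Pm. \<Sum>js\<in>?W.
      of_int (sign p) * ((\<Prod>i<k. (\<alpha>s ! i) (u (js ! p i))) * F (map e js)))"
    by (rule sum.swap)
  also have "\<dots> = fact k * F \<alpha>s"
    using card_permutations[of "{..<k}" k] by (simp add: *)
  finally show ?thesis .
qed

text \<open>The wedges of covectors span the alternating forms, and the covectors separate the vectors.\<close>

lemma is_sharp_unique:
  assumes "is_sharp n V P L" "is_sharp n V P L'"
  shows "L = L'"
proof
  fix \<omega>
  let ?A = "alt_forms (n - 1) V" and ?W = "{js. length js = n - 1 \<and> set js \<subseteq> I}"
  show "L \<omega> = L' \<omega>"
  proof (cases "\<omega> \<in> ?A")
    case True
    have eq: "L (wedge V \<alpha>s) = L' (wedge V \<alpha>s)"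
      if "length \<alpha>s = n - 1" "set \<alpha>s \<subseteq> dual_space V" for \<alpha>s
      using assms that wedge_dual[OF that(2,1)] unfolding is_sharp_def by (intro dual_separates) auto
    have "(\<Sum>js\<in>?W. \<omega> (map u js) *\<^sub>R L (wedge V (map e js))) =
        (\<Sum>js\<in>?W. \<omega> (map u js) *\<^sub>R L' (wedge V (map e js)))"
      using map_e by (intro sum.cong refl) (auto simp: eq)
    moreover have "linear_on ?A L" "linear_on ?A L'" using assms by (simp_all add: is_sharp_def)
    ultimately show ?thesis by (simp only: linear_alt_form_expand[OF _ True])
  qed (use assms in \<open>simp add: is_sharp_def\<close>)
qed

lemma sharp_eqI: "is_sharp n V P L \<Longrightarrow> sharp n V P = L"
  unfolding sharp_eq_The by (rule the_equality) (auto intro: is_sharp_unique)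

text \<open>Existence: contract \<open>\<omega>\<close> with the first \<open>n - 1\<close> slots of \<open>P\<close> in terms of the frame. On wedges this
contraction has the required values by the pairing formula.\<close>

lemma is_sharp_sharp:
  assumes "P \<in> alt_forms n (dual_space V)" "n \<ge> 1"
  shows "is_sharp n V P (sharp n V P)"
proof -
  obtain k where k: "n = Suc k" using assms(2) by (cases n) auto
  let ?W = "{js. length js = k \<and> set js \<subseteq> I}" and ?A = "alt_forms k V"
  note D = subspace_dual_space[OF subspace]
  note P = alt_forms_multilinear[OF assms(1), unfolded k] alt_forms_skew[OF assms(1), unfolded k]
  define L where "L \<omega> = (if \<omega> \<in> ?A then (1 / fact k) *\<^sub>R
      (\<Sum>js\<in>?W. \<Sum>j\<in>I. (\<omega> (map u js) * P (map e js @ [e j])) *\<^sub>R u j) else 0)" for \<omega>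
  have L_in: "L \<omega> \<in> V" for \<omega>
  proof (cases "\<omega> \<in> ?A")
    case True
    then show ?thesis unfolding L_def if_P[OF True]
      by (intro subspace_scale[OF subspace] subspace_sum[OF subspace] u)
  qed (simp add: L_def subspace_0[OF subspace])
  have L_out: "L \<omega> = 0" if "\<omega> \<notin> ?A" for \<omega>
    using that by (simp add: L_def)
  have "linear_on ?A L"
    by (rule linear_onI[OF _ _ subspace_alt_forms])
      (simp_all add: L_def subspace_add subspace_scale subspace_alt_forms algebra_simps sum.distrib
        scaleR_sum_right)
  moreover have "\<beta> (L (wedge V \<alpha>s)) = P (\<alpha>s @ [\<beta>])"
    if \<alpha>s: "length \<alpha>s = k" "set \<alpha>s \<subseteq> dual_space V" and \<beta>: "\<beta> \<in> dual_space V" for \<alpha>s \<beta>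
  proof -
    have lin: "linear_on V \<beta>" using \<beta> by (simp add: dual_space_def)
    have last: "P (map e js @ [\<beta>]) = (\<Sum>j\<in>I. \<beta> (u j) * P (map e js @ [e j]))" if "js \<in> ?W" for js
    proof -
      have linP: "linear_on (dual_space V) (\<lambda>\<beta>. P (map e js @ [\<beta>]))"
        using that map_e by (intro linear_on_last[OF P(1)] subspace_0[OF D]) auto
      have "P (map e js @ [\<beta>]) = P (map e js @ [\<Sum>j\<in>I. \<beta> (u j) *\<^sub>R e j])"
        using dual_expand[OF \<beta>] by simp
      also have "\<dots> = (\<Sum>j\<in>I. P (map e js @ [\<beta> (u j) *\<^sub>R e j]))"
        using e by (intro linear_on_sum[OF linP D] subspace_scale[OF D]) auto
      also have "\<dots> = (\<Sum>j\<in>I. \<beta> (u j) * P (map e js @ [e j]))"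
        using e linear_on_scale[OF linP D] by simp
      finally show ?thesis .
    qed
    have "\<beta> (L (wedge V \<alpha>s)) = (1 / fact k) *
        (\<Sum>js\<in>?W. \<Sum>j\<in>I. (wedge V \<alpha>s (map u js) * P (map e js @ [e j])) * \<beta> (u j))"
      using wedge_dual[OF \<alpha>s(2,1)] u unfolding L_def
      by (simp add: linear_on_scale[OF lin subspace] linear_on_sum[OF lin subspace]
          subspace_sum[OF subspace] subspace_scale[OF subspace])
    also have "\<dots> = (1 / fact k) * (\<Sum>js\<in>?W. wedge V \<alpha>s (map u js) * P (map e js @ [\<beta>]))"
      using last by (simp add: sum_distrib_left mult_ac)
    also have "\<dots> = P (\<alpha>s @ [\<beta>])"
      using sum_wedge_pairing[OF multilinear_on_snoc[OF P(1) \<beta>] skew_symmetric_on_snoc[OF P(2) \<beta>] \<alpha>s]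
      by simp
    finally show ?thesis .
  qed
  ultimately have "is_sharp n V P L"
    using L_in by (auto simp: is_sharp_def k L_out)
  then show ?thesis using sharp_eqI by metis
qed

text \<open>The span of the values of \<open>P\<^sup>\<sharp>\<close> on wedges is its whole image, because wedges span.\<close>

lemma span_sharp_wedge:
  assumes "is_sharp n V P L"
  shows "span {L (wedge V \<alpha>s) | \<alpha>s. length \<alpha>s = n - 1 \<and> set \<alpha>s \<subseteq> dual_space V} =
    L ` alt_forms (n - 1) V"
    (is "span ?H = L ` ?A")
proof
  let ?W = "{js. length js = n - 1 \<and> set js \<subseteq> I}"
  have lin: "linear_on ?A L" using assms by (simp add: is_sharp_def)
  note lin = linear_on_add[OF lin subspace_alt_forms] linear_on_scale[OF lin subspace_alt_forms]
    linear_on_sum[OF lin subspace_alt_forms]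
  have "subspace (L ` ?A)"
  proof (rule subspaceI)
    show "0 \<in> L ` ?A"
      using lin(2)[OF subspace_0[OF subspace_alt_forms], of 0] subspace_0[OF subspace_alt_forms]
      by (metis image_eqI scale_zero_left)
    show "x + y \<in> L ` ?A" if "x \<in> L ` ?A" "y \<in> L ` ?A" for x y
      using that lin(1) subspace_add[OF subspace_alt_forms] by (smt (verit) image_iff)
    show "c *\<^sub>R x \<in> L ` ?A" if "x \<in> L ` ?A" for x c
      using that lin(2) subspace_scale[OF subspace_alt_forms] by (smt (verit) image_iff)
  qed
  then show "span ?H \<subseteq> L ` ?A"
    by (intro span_minimal) (auto intro: wedge_dual)
  show "L ` ?A \<subseteq> span ?H"
  proof
    fix x assume "x \<in> L ` ?A"
    then obtain \<omega> where \<omega>: "\<omega> \<in> ?A" "x = L \<omega>" by auto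
    have "L \<omega> = (1 / fact (n - 1)) *\<^sub>R (\<Sum>js\<in>?W. \<omega> (map u js) *\<^sub>R L (wedge V (map e js)))"
      using assms \<omega>(1) unfolding is_sharp_def by (intro linear_alt_form_expand) auto
    also have "\<dots> \<in> span ?H"
    proof (intro span_scale span_sum span_base)
      fix js assume "js \<in> ?W"
      then have "length (map e js) = n - 1" "set (map e js) \<subseteq> dual_space V"
        using map_e by auto
      then show "L (wedge V (map e js)) \<in> ?H" by blast
    qed
    finally show "x \<in> span ?H" using \<omega>(2) by simp
  qed
qed

end

lemma linear_on_inv_into:
  assumes "subspace W" "linear_on W T" "bij_betw T W W"
  shows "linear_on W (inv_into W T)"
proof (rule linear_onI[OF _ _ assms(1)])
  have inv: "inv_into W T x \<in> W" "T (inv_into W T x) = x" if "x \<in> W" for x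
    using that assms(3) by (auto simp: bij_betw_def inv_into_into f_inv_into_f)
  have eqI: "inv_into W T x = y" if "y \<in> W" "T y = x" for x y
    using that assms(3) by (auto simp: bij_betw_def inv_into_f_f)
  show "inv_into W T (x + y) = inv_into W T x + inv_into W T y" if "x \<in> W" "y \<in> W" for x y
    using that by (intro eqI) (simp_all add: inv subspace_add[OF assms(1)] linear_on_add[OF assms(2,1)])
  show "inv_into W T (c *\<^sub>R x) = c *\<^sub>R inv_into W T x" if "x \<in> W" for x c
    using that by (intro eqI) (simp_all add: inv subspace_scale[OF assms(1)] linear_on_scale[OF assms(2,1)])
qed

lemma interior_product_linear:
  assumes "subspace V" "b \<in> alt_forms (Suc k) V"
  shows "linear_on V (\<lambda>v. interior_product v b)"
proof -
  have "linear_on V (\<lambda>v. b (v # vs))" for vs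
  proof (cases "length vs = k \<and> set vs \<subseteq> V")
    case True
    then have "linear_on V (\<lambda>v. b ((0 # vs)[0 := v]))"
      using alt_forms_multilinear[OF assms(2)] subspace_0[OF assms(1)] unfolding multilinear_on_def
      by (metis insert_subset length_Cons list.simps(15) zero_less_Suc)
    then show ?thesis by simp
  next
    case False
    then have "b (v # vs) = 0" for v by (intro alt_forms_outside[OF assms(2)]) auto
    then show ?thesis by (simp add: linear_on_def)
  qed
  then show ?thesis by (auto simp: linear_on_def interior_product_def fun_eq_iff)
qed

text \<open>By the uniqueness of \<open>\<sharp>\<close>, the defining equation of the gauge transformation gives
\<open>Q\<^sup>\<sharp> = P\<^sup>\<sharp> \<circ> (Id + b \<circ> P\<^sup>\<sharp>)\<^sup>-\<^sup>1\<close>. The right factor is a bijection of the space of forms, so the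
image does not change.\<close>

lemma (in finite_frame) sharp_gauge:
  assumes P: "P \<in> alt_forms n (dual_space V)" and "n \<ge> 1" and b: "b \<in> alt_forms n V"
    and bij: "bij_betw (id_plus_flat_sharp n V P b) (alt_forms (n - 1) V) (alt_forms (n - 1) V)"
    and Q: "\<And>\<alpha>s \<beta>. length \<alpha>s = n - 1 \<Longrightarrow> set \<alpha>s \<subseteq> dual_space V \<Longrightarrow> \<beta> \<in> dual_space V \<Longrightarrow>
      Q (\<alpha>s @ [\<beta>]) = \<beta> (sharp n V P (inv_into (alt_forms (n - 1) V) (id_plus_flat_sharp n V P b) (wedge V \<alpha>s)))"
  shows "is_sharp n V Q (sharp n V Q)"
    and "sharp n V Q ` alt_forms (n - 1) V = sharp n V P ` alt_forms (n - 1) V"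
proof -
  let ?A = "alt_forms (n - 1) V" and ?T = "id_plus_flat_sharp n V P b"
  let ?L = "\<lambda>\<omega>. if \<omega> \<in> ?A then sharp n V P (inv_into ?A ?T \<omega>) else 0"
  note A = subspace_alt_forms[of "n - 1" V]
  have P': "is_sharp n V P (sharp n V P)" using P \<open>n \<ge> 1\<close> by (rule is_sharp_sharp)
  then have lin: "linear_on ?A (sharp n V P)" and range: "\<And>\<omega>. \<omega> \<in> ?A \<Longrightarrow> sharp n V P \<omega> \<in> V"
    by (auto simp: is_sharp_def)
  have "linear_on V (\<lambda>v. interior_product v b)"
    using interior_product_linear[OF subspace, of b "n - 1"] b \<open>n \<ge> 1\<close> by simp
  note int = linear_on_add[OF this subspace] linear_on_scale[OF this subspace]
  have "linear_on ?A ?T"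
    by (rule linear_onI[OF _ _ A])
      (simp_all add: id_plus_flat_sharp_def linear_on_add[OF lin A] linear_on_scale[OF lin A] int range
        algebra_simps)
  then have inv: "linear_on ?A (inv_into ?A ?T)" using linear_on_inv_into[OF A _ bij] by simp
  have inv_img: "inv_into ?A ?T ` ?A = ?A"
    using bij_betw_inv_into[OF bij] by (simp add: bij_betw_def)
  then have inv_in: "inv_into ?A ?T \<omega> \<in> ?A" if "\<omega> \<in> ?A" for \<omega> using that by blast
  have "linear_on ?A ?L"
    by (rule linear_onI[OF _ _ A])
      (simp_all add: subspace_add[OF A] subspace_scale[OF A] linear_on_add[OF inv A]
        linear_on_scale[OF inv A] linear_on_add[OF lin A] linear_on_scale[OF lin A] inv_in
        del: One_nat_def)
  then have L: "is_sharp n V Q ?L"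
    using Q by (auto simp: is_sharp_def range inv_in wedge_dual simp del: One_nat_def)
  then have eq: "sharp n V Q = ?L" by (rule sharp_eqI)
  show "is_sharp n V Q (sharp n V Q)" using L eq by simp
  have "?L ` ?A = sharp n V P ` (inv_into ?A ?T ` ?A)" by (auto simp: image_iff)
  then show "sharp n V Q ` ?A = sharp n V P ` ?A" by (simp only: eq inv_img)
qed

section \<open>Tangent spaces of a manifold\<close>

lemma smooth_functionsD:
  "f \<in> smooth_functions A \<Longrightarrow> (U, \<phi>) \<in> A \<Longrightarrow> smooth_on (\<phi> ` U) (f \<circ> inv_into U \<phi>)"
  by (auto simp: smooth_functions_def)

locale chart_at =
  fixes X :: "'a topology" and A :: "('a, 'b::euclidean_space) atlas"
    and U :: "'a set" and \<phi> :: "'a \<Rightarrow> 'b" and m :: 'a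
  assumes manifold: "smooth_manifold X A" and chart: "(U, \<phi>) \<in> A" and m: "m \<in> U"
begin

lemma
  assumes "(W, \<psi>) \<in> A"
  shows chart_openin: "openin X W"
    and chart_open: "open (\<psi> ` W)"
    and chart_homeo: "homeomorphic_map (subtopology X W) (top_of_set (\<psi> ` W)) \<psi>"
  using manifold assms unfolding smooth_manifold_def by blast+

lemma chart_transition:
  "(W, \<psi>) \<in> A \<Longrightarrow> (W', \<psi>') \<in> A \<Longrightarrow> smooth_on (\<psi> ` (W \<inter> W')) (\<psi>' \<circ> inv_into W \<psi>)"
  using manifold by (auto simp: smooth_manifold_def)

lemma chart_topspace: "(W, \<psi>) \<in> A \<Longrightarrow> topspace (subtopology X W) = W"
  using openin_subset[OF chart_openin] by auto

lemma chart_inj: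
  assumes "(W, \<psi>) \<in> A"
  shows "inj_on \<psi> W"
  using homeomorphic_imp_injective_map[OF chart_homeo[OF assms]]
  unfolding chart_topspace[OF assms] .

lemma chart_open_image:
  assumes "(W, \<psi>) \<in> A" "openin X S"
  shows "open (\<psi> ` (W \<inter> S))"
proof -
  have "openin (subtopology X W) (W \<inter> S)"
    using assms(2) by (auto simp: openin_subtopology Int_commute)
  then have "openin (top_of_set (\<psi> ` W)) (\<psi> ` (W \<inter> S))"
    using homeomorphic_imp_open_map[OF chart_homeo[OF assms(1)]] by (simp add: open_map_def)
  then show ?thesis using chart_open[OF assms(1)] openin_open_trans by blast
qed

definition chart_lift :: "('b \<Rightarrow> real) \<Rightarrow> 'a \<Rightarrow> real" where
  "chart_lift h x = (if x \<in> U then h (\<phi> x) else 0)"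

text \<open>The preimage \<open>K\<close> of the closed ball in the chart is compact, hence closed in the Hausdorff space \<open>M\<close>.
Every other chart \<open>W\<close> is therefore covered by the open sets \<open>W \<inter> U\<close>, where the lift is \<open>h\<close> composed with
a transition map, and \<open>W - K\<close>, where it is zero.\<close>

lemma chart_lift_smooth:
  assumes h: "smooth_on UNIV h" and r: "cball a r \<subseteq> \<phi> ` U"
    and outside: "\<And>y. y \<notin> cball a r \<Longrightarrow> h y = 0"
  shows "chart_lift h \<in> smooth_functions A"
proof -
  define K where "K = {x \<in> U. \<phi> x \<in> cball a r}"
  have "\<phi> ` K = cball a r" using r unfolding K_def by blast
  then have "compactin (top_of_set (\<phi> ` U)) (\<phi> ` K)"
    using r by (simp add: compactin_subtopology)
  then have "compactin (subtopology X U) K"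
    using homeomorphic_map_compactness_eq[OF chart_homeo[OF chart], of K] chart_topspace[OF chart]
    by (auto simp: K_def)
  then have "compactin X K" by (simp add: compactin_subtopology)
  moreover have "Hausdorff_space X" using manifold by (simp add: smooth_manifold_def)
  ultimately have "closedin X K" by (intro compactin_imp_closedin)
  then have openK: "openin X (topspace X - K)" by auto
  have "Ck_on k (\<psi> ` W) (chart_lift h \<circ> inv_into W \<psi>)" if W: "(W, \<psi>) \<in> A" for W \<psi> k
  proof -
    have inv: "inv_into W \<psi> (\<psi> x) = x" if "x \<in> W" for x
      using chart_inj[OF W] that by simp
    let ?S = "\<psi> ` (W \<inter> U)" and ?T = "\<psi> ` (W \<inter> (topspace X - K))"
    have S: "open ?S" by (rule chart_open_image[OF W chart_openin[OF chart]])
    have T: "open ?T" by (rule chart_open_image[OF W openK])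
    have "W \<subseteq> topspace X" using chart_openin[OF W] by (rule openin_subset)
    then have cover: "\<psi> ` W = ?S \<union> ?T" by (auto simp: K_def)
    note chart_transition[OF W chart]
    then have "Ck_on k ?S (\<lambda>y. h ((\<phi> \<circ> inv_into W \<psi>) y))"
      using h Ck_on_compose[OF S, of "\<phi> \<circ> inv_into W \<psi>" UNIV k h] by (simp add: smooth_on_def)
    then have "Ck_on k ?S (chart_lift h \<circ> inv_into W \<psi>)"
      by (rule Ck_on_transform[OF S, rotated]) (auto simp: chart_lift_def inv)
    moreover have "Ck_on k ?T (chart_lift h \<circ> inv_into W \<psi>)"
      by (rule Ck_on_transform[OF T _ Ck_on_const[OF T, where c = 0]])
        (use outside in \<open>force simp: chart_lift_def inv K_def\<close>)+
    ultimately show ?thesis unfolding cover by (intro Ck_on_Un S T)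
  qed
  then show ?thesis by (auto simp: smooth_functions_def smooth_on_def)
qed

lemma smooth_functions_const: "(\<lambda>_. c) \<in> smooth_functions A"
  by (auto simp: smooth_functions_def smooth_on_def o_def intro: Ck_on_const chart_open)

lemma smooth_functions_mult:
  "f \<in> smooth_functions A \<Longrightarrow> g \<in> smooth_functions A \<Longrightarrow> f * g \<in> smooth_functions A"
  by (auto simp: smooth_functions_def smooth_on_def o_def dest: chart_open intro!: Ck_on_mult)

lemma subspace_smooth_functions: "subspace (smooth_functions A)"
proof (rule subspaceI)
  show "0 \<in> smooth_functions A" using smooth_functions_const[of 0] by (simp add: zero_fun_def)
  fix f assume f: "f \<in> smooth_functions A"
  show "f + g \<in> smooth_functions A" if "g \<in> smooth_functions A" for g
    using f that by (auto simp: smooth_functions_def smooth_on_def o_def dest: chart_open intro!: Ck_on_add)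
  show "c *\<^sub>R f \<in> smooth_functions A" for c
  proof -
    have "c *\<^sub>R f = (\<lambda>_. c) * f" by (simp add: fun_eq_iff)
    then show ?thesis using smooth_functions_mult[OF smooth_functions_const f] by simp
  qed
qed

lemma tangentD:
  assumes "v \<in> tangent_space A m"
  shows tangent_linear: "linear_on (smooth_functions A) v"
    and tangent_outside: "f \<notin> smooth_functions A \<Longrightarrow> v f = 0"
    and tangent_leibniz: "f \<in> smooth_functions A \<Longrightarrow> g \<in> smooth_functions A \<Longrightarrow>
      v (f * g) = f m * v g + g m * v f"
  using assms by (auto simp: tangent_space_def dual_space_def)

lemma tangent_const:
  assumes "v \<in> tangent_space A m"
  shows "v (\<lambda>_. c) = 0"
proof -
  note one = smooth_functions_const[of 1]
  have "(\<lambda>_. 1) * (\<lambda>_. 1) = (\<lambda>_ :: 'a. 1 :: real)" by (simp add: fun_eq_iff)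
  then have "v (\<lambda>_. 1) = 0" using tangent_leibniz[OF assms one one] by simp
  moreover have "(\<lambda>_. c) = c *\<^sub>R (\<lambda>_ :: 'a. 1 :: real)" by (simp add: fun_eq_iff)
  ultimately show ?thesis
    using linear_on_scale[OF tangent_linear[OF assms] subspace_smooth_functions one, of c] by simp
qed

lemma subspace_tangent_space: "subspace (tangent_space A m)"
  using subspace_dual_space[OF subspace_smooth_functions]
  by (auto simp: subspace_def tangent_space_def algebra_simps)

text \<open>The tangent vectors \<open>\<partial>/\<partial>x\<^sub>b\<close> at \<open>m\<close> in the chart \<open>\<phi>\<close>.\<close>

definition coordinate_derivation :: "'b \<Rightarrow> 'a tangent_vector" where
  "coordinate_derivation b f = (if f \<in> smooth_functions A
    then frechet_derivative (f \<circ> inv_into U \<phi>) (at (\<phi> m)) b else 0)"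

lemma chart_has_derivative:
  assumes "f \<in> smooth_functions A"
  shows "((f \<circ> inv_into U \<phi>) has_derivative frechet_derivative (f \<circ> inv_into U \<phi>) (at (\<phi> m)))
    (at (\<phi> m))"
proof -
  have "Ck_on (Suc 0) (\<phi> ` U) (f \<circ> inv_into U \<phi>)"
    using smooth_functionsD[OF assms chart] by (simp only: smooth_on_def)
  then show ?thesis using Ck_on_SucD(1) m by blast
qed

lemma inv_chart: "x \<in> U \<Longrightarrow> inv_into U \<phi> (\<phi> x) = x"
  using chart_inj[OF chart] by simp

lemma coordinate_derivation_eqI:
  assumes "f \<in> smooth_functions A" "((f \<circ> inv_into U \<phi>) has_derivative D) (at (\<phi> m))"
  shows "coordinate_derivation b f = D b"
  using assms frechet_derivative_at[OF assms(2)] by (simp add: coordinate_derivation_def)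

lemma coordinate_derivation_tangent: "coordinate_derivation b \<in> tangent_space A m"
proof -
  let ?D = "\<lambda>f. frechet_derivative (f \<circ> inv_into U \<phi>) (at (\<phi> m))"
  note S = subspace_smooth_functions
  have "linear_on (smooth_functions A) (coordinate_derivation b)"
  proof (rule linear_onI[OF _ _ S])
    fix f g assume f: "f \<in> smooth_functions A"
    show "coordinate_derivation b (c *\<^sub>R f) = c *\<^sub>R coordinate_derivation b f" for c
    proof -
      have "((\<lambda>x. c *\<^sub>R (f \<circ> inv_into U \<phi>) x) has_derivative (\<lambda>v. c *\<^sub>R ?D f v)) (at (\<phi> m))"
        by (intro has_derivative_scaleR_right chart_has_derivative f)
      then have "coordinate_derivation b (c *\<^sub>R f) = c *\<^sub>R ?D f b"
        by (intro coordinate_derivation_eqI subspace_scale[OF S] f) (simp add: o_def)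
      then show ?thesis using f by (simp add: coordinate_derivation_def)
    qed
    assume g: "g \<in> smooth_functions A"
    have "((\<lambda>x. (f \<circ> inv_into U \<phi>) x + (g \<circ> inv_into U \<phi>) x) has_derivative (\<lambda>v. ?D f v + ?D g v))
        (at (\<phi> m))"
      by (intro has_derivative_add chart_has_derivative f g)
    then have "coordinate_derivation b (f + g) = ?D f b + ?D g b"
      by (intro coordinate_derivation_eqI subspace_add[OF S] f g) (simp add: o_def)
    then show "coordinate_derivation b (f + g) = coordinate_derivation b f + coordinate_derivation b g" using f g by (simp add: coordinate_derivation_def)
  qed
  moreover have "coordinate_derivation b (f * g) = f m * coordinate_derivation b g + g m * coordinate_derivation b f"
    if f: "f \<in> smooth_functions A" and g: "g \<in> smooth_functions A" for f g
  proof -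
    have "((\<lambda>x. (f \<circ> inv_into U \<phi>) x * (g \<circ> inv_into U \<phi>) x) has_derivative
        (\<lambda>v. (f \<circ> inv_into U \<phi>) (\<phi> m) * ?D g v + ?D f v * (g \<circ> inv_into U \<phi>) (\<phi> m))) (at (\<phi> m))"
      by (intro has_derivative_mult chart_has_derivative f g)
    then have "coordinate_derivation b (f * g) =
        (f \<circ> inv_into U \<phi>) (\<phi> m) * ?D g b + ?D f b * (g \<circ> inv_into U \<phi>) (\<phi> m)"
      by (intro coordinate_derivation_eqI smooth_functions_mult f g) (simp add: o_def)
    then show ?thesis using f g m by (simp add: coordinate_derivation_def inv_chart mult.commute)
  qed
  moreover have "coordinate_derivation b f = 0" if "f \<notin> smooth_functions A" for f
    using that by (simp add: coordinate_derivation_def)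
  ultimately show ?thesis by (simp add: tangent_space_def dual_space_def)
qed

text \<open>With \<open>\<theta>\<close> a bump function at \<open>a = \<phi> m\<close> and \<open>c\<^sub>b\<close> the globalised coordinate \<open>(x\<^sub>b - a\<^sub>b) \<theta>\<close>, Hadamard's lemma
gives \<open>\<theta>\<^sup>2 (f - f m) = \<Sum>\<^sub>b c\<^sub>b \<gamma>\<^sub>b\<close> on all of \<open>M\<close>, where \<open>\<gamma>\<^sub>b\<close> is \<open>\<theta>\<close> times the Hadamard coefficient, so that
\<open>\<gamma>\<^sub>b(m) = \<partial>f/\<partial>x\<^sub>b\<close>. Each of the two factors \<open>\<theta>\<close> makes one factor on the right globally defined. A
derivation at \<open>m\<close> takes the left-hand side to \<open>v f\<close>, because \<open>f - f m\<close> vanishes at \<open>m\<close> and \<open>\<theta>(a) = 1\<close>, and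
the right-hand side to \<open>\<Sum>\<^sub>b v(c\<^sub>b) \<gamma>\<^sub>b(m)\<close>, because \<open>c\<^sub>b(m) = 0\<close>.\<close>

lemma tangent_frame:
  obtains c where "\<And>b. c b \<in> smooth_functions A"
    and "\<And>v. v \<in> tangent_space A m \<Longrightarrow> v = (\<Sum>b\<in>Basis. v (c b) *\<^sub>R coordinate_derivation b)"
proof -
  define a where "a = \<phi> m"
  have "a \<in> \<phi> ` U" using m by (simp add: a_def)
  then obtain R where R: "R > 0" "ball a R \<subseteq> \<phi> ` U"
    using chart_open[OF chart] open_contains_ball by blast
  define r where "r = R / 2"
  have r: "r > 0" "cball a r \<subseteq> ball a R" "cball a r \<subseteq> \<phi> ` U"
    using R by (auto simp: r_def)
  obtain \<theta> :: "'b \<Rightarrow> real" where \<theta>: "smooth_on UNIV \<theta>" "\<theta> a = 1" "\<And>x. x \<notin> ball a r \<Longrightarrow> \<theta> x = 0"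
    using smooth_bump[OF r(1), where a = a] by blast
  define \<kappa> where "\<kappa> = chart_lift \<theta>"
  define c where "c b = chart_lift (\<lambda>x. (x - a) \<bullet> b * \<theta> x)" for b
  have \<kappa>: "\<kappa> \<in> smooth_functions A"
    unfolding \<kappa>_def using \<theta> by (intro chart_lift_smooth[OF _ r(3)]) auto
  have c: "c b \<in> smooth_functions A" for b
    unfolding c_def using \<theta>
    by (intro chart_lift_smooth[OF _ r(3)])
      (auto simp: smooth_on_def intro!: Ck_on_mult Ck_on_affine)
  note S = subspace_smooth_functions
  have expansion: "v f = (\<Sum>b\<in>Basis. v (c b) * coordinate_derivation b f)"
    if v: "v \<in> tangent_space A m" and f: "f \<in> smooth_functions A" for v f
  proof -
    define F where "F = f \<circ> inv_into U \<phi>"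
    define G where "G b = ray_average a 0 (\<lambda>y. frechet_derivative F (at y) b)" for b
    define \<gamma> where "\<gamma> b = chart_lift (\<lambda>x. \<theta> x * G b x)" for b
    have F: "smooth_on (ball a R) F"
      using smooth_functionsD[OF f chart] Ck_on_subset R(2) unfolding smooth_on_def F_def by blast
    have G: "Ck_on k (ball a R) (G b)" for k b
    proof -
      have "Ck_on (Suc k) (ball a R) F" using F by (simp only: smooth_on_def)
      then show ?thesis unfolding G_def by (intro Ck_on_ray_average Ck_on_SucD(2))
    qed
    have "smooth_on UNIV (\<lambda>x. \<theta> x * G b x)" for b
      unfolding smooth_on_def
    proof
      fix k
      have "Ck_on k (ball a R) (\<lambda>x. \<theta> x * G b x)"
        using \<theta>(1) Ck_on_mult[OF open_ball Ck_on_subset[of k UNIV \<theta> "ball a R"] G]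
        by (simp add: smooth_on_def)
      moreover have "Ck_on k (- cball a r) (\<lambda>x. \<theta> x * G b x)"
        by (rule Ck_on_transform[OF _ _ Ck_on_const[where c = 0]]) (auto simp: \<theta>(3) simp flip: closed_def)
      ultimately have "Ck_on k (ball a R \<union> - cball a r) (\<lambda>x. \<theta> x * G b x)"
        by (intro Ck_on_Un) auto
      moreover have "ball a R \<union> - cball a r = UNIV" using r(2) by auto
      ultimately show "Ck_on k UNIV (\<lambda>x. \<theta> x * G b x)" by simp
    qed
    then have \<gamma>: "\<gamma> b \<in> smooth_functions A" for b
      unfolding \<gamma>_def using \<theta>(3) by (intro chart_lift_smooth[OF _ r(3)]) auto
    define g where "g = f + (\<lambda>_. - f m)"
    have g: "g \<in> smooth_functions A"
      unfolding g_def by (intro subspace_add[OF S] f smooth_functions_const)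
    \<comment> \<open>On \<open>U\<close> but away from the ball where Hadamard's lemma applies, both sides vanish with \<open>\<theta>\<close>.\<close>
    have "(\<kappa> * \<kappa>) * g = (\<Sum>b\<in>Basis. c b * \<gamma> b)"
    proof
      fix x
      have "\<theta> (\<phi> x) * \<theta> (\<phi> x) * (f x - f m) =
          (\<Sum>b\<in>Basis. ((\<phi> x - a) \<bullet> b * \<theta> (\<phi> x)) * (\<theta> (\<phi> x) * G b (\<phi> x)))" if x: "x \<in> U"
      proof (cases "\<phi> x \<in> ball a R")
        case True
        have "f x - f m = F (\<phi> x) - F a" using x m by (simp add: F_def a_def inv_chart)
        also have "\<dots> = (\<Sum>b\<in>Basis. ((\<phi> x - a) \<bullet> b) * G b (\<phi> x))"
          unfolding G_def by (rule hadamard[OF F True])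
        finally show ?thesis by (simp add: sum_distrib_left mult_ac)
      next
        case False
        then have "\<phi> x \<notin> ball a r" using r(2) ball_subset_cball by blast
        then show ?thesis by (simp add: \<theta>(3))
      qed
      then show "((\<kappa> * \<kappa>) * g) x = (\<Sum>b\<in>Basis. c b * \<gamma> b) x"
        by (simp add: fun_sum_apply \<kappa>_def c_def \<gamma>_def g_def chart_lift_def)
    qed
    moreover have "v ((\<kappa> * \<kappa>) * g) = v f"
    proof -
      have "v ((\<kappa> * \<kappa>) * g) = (\<kappa> * \<kappa>) m * v g + g m * v (\<kappa> * \<kappa>)"
        by (intro tangent_leibniz[OF v] smooth_functions_mult \<kappa> g)
      also have "\<dots> = v g" using m \<theta>(2) by (simp add: \<kappa>_def chart_lift_def g_def a_def)
      also have "\<dots> = v f"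
        unfolding g_def
        by (simp add: linear_on_add[OF tangent_linear[OF v] S f smooth_functions_const] tangent_const[OF v])
      finally show ?thesis .
    qed
    moreover have "v (\<Sum>b\<in>Basis. c b * \<gamma> b) = (\<Sum>b\<in>Basis. v (c b) * coordinate_derivation b f)"
    proof -
      have "c b m = 0" "\<gamma> b m = coordinate_derivation b f" for b
        using m f \<theta>(2)
        by (simp_all add: c_def \<gamma>_def chart_lift_def G_def ray_average_at coordinate_derivation_def F_def flip: a_def)
      then have "v (c b * \<gamma> b) = v (c b) * coordinate_derivation b f" for b
        using tangent_leibniz[OF v c \<gamma>] by simp
      then show ?thesis
        by (simp add: linear_on_sum[OF tangent_linear[OF v] S] smooth_functions_mult c \<gamma>)
    qed
    ultimately show ?thesis by simp
  qed
  have "v = (\<Sum>b\<in>Basis. v (c b) *\<^sub>R coordinate_derivation b)" if "v \<in> tangent_space A m" for v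
  proof (intro ext)
    fix f
    show "v f = (\<Sum>b\<in>Basis. v (c b) *\<^sub>R coordinate_derivation b) f"
    proof (cases "f \<in> smooth_functions A")
      case False
      then show ?thesis by (simp add: fun_sum_apply tangent_outside[OF that] coordinate_derivation_def)
    qed (use expansion[OF that] in \<open>simp add: fun_sum_apply\<close>)
  qed
  then show ?thesis using that c by blast
qed

lemma differential_in_cotangent: "differential A f m \<in> cotangent_space A m"
  using subspace_tangent_space
  by (auto simp: cotangent_space_def dual_space_def differential_def subspace_add subspace_scale
      intro!: linear_onI)

lemma tangent_finite_frame:
  obtains c where "\<And>b. c b \<in> smooth_functions A"
    and "finite_frame (tangent_space A m) Basis coordinate_derivation (\<lambda>b. differential A (c b) m)"
proof -
  obtain c where c: "\<And>b. c b \<in> smooth_functions A"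
    and frame: "\<And>v. v \<in> tangent_space A m \<Longrightarrow> v = (\<Sum>b\<in>Basis. v (c b) *\<^sub>R coordinate_derivation b)"
    using tangent_frame by blast
  have "finite_frame (tangent_space A m) Basis coordinate_derivation (\<lambda>b. differential A (c b) m)"
  proof
    fix v assume v: "v \<in> tangent_space A m"
    then show "v = (\<Sum>b\<in>Basis. differential A (c b) m v *\<^sub>R coordinate_derivation b)"
      using frame[OF v] by (simp add: differential_def)
  qed (use subspace_tangent_space coordinate_derivation_tangent differential_in_cotangent in
      \<open>auto simp: cotangent_space_def\<close>)
  with c show ?thesis using that by blast
qed

text \<open>A covector is a combination of the differentials of the functions \<open>c\<^sub>b\<close>, and differentials depend
linearly on the function. Hamiltonian vector fields hence take at \<open>m\<close> all the values
\<open>P\<^sup>\<sharp>(\<alpha>\<^sub>1 \<and> \<dots> \<and> \<alpha>\<^sub>n\<^sub>-\<^sub>1)\<close> with arbitrary covectors \<open>\<alpha>\<^sub>i\<close>.\<close>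

lemma cotangent_space_eq: "cotangent_space A m = (\<lambda>f. differential A f m) ` smooth_functions A"
proof
  show "(\<lambda>f. differential A f m) ` smooth_functions A \<subseteq> cotangent_space A m"
    using differential_in_cotangent by blast
  show "cotangent_space A m \<subseteq> (\<lambda>f. differential A f m) ` smooth_functions A"
  proof
    fix \<alpha> assume \<alpha>: "\<alpha> \<in> cotangent_space A m"
    obtain c where c: "\<And>b. c b \<in> smooth_functions A"
      and "finite_frame (tangent_space A m) Basis coordinate_derivation (\<lambda>b. differential A (c b) m)"
      using tangent_finite_frame by blast
    then interpret finite_frame "tangent_space A m" Basis coordinate_derivation "\<lambda>b. differential A (c b) m"
      by simp
    let ?f = "\<Sum>b\<in>Basis. \<alpha> (coordinate_derivation b) *\<^sub>R c b"
    have f: "?f \<in> smooth_functions A"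
      by (intro subspace_sum subspace_scale subspace_smooth_functions c)
    have "\<alpha> = (\<Sum>b\<in>Basis. \<alpha> (coordinate_derivation b) *\<^sub>R differential A (c b) m)"
      using dual_expand \<alpha> by (simp add: cotangent_space_def)
    also have "\<dots> = differential A ?f m"
    proof
      fix v
      note S = subspace_smooth_functions
      show "(\<Sum>b\<in>Basis. \<alpha> (coordinate_derivation b) *\<^sub>R differential A (c b) m) v = differential A ?f m v"
        by (simp add: fun_sum_apply differential_def linear_on_sum[OF tangent_linear S]
            linear_on_scale[OF tangent_linear S] subspace_scale[OF S] c)
    qed
    finally show "\<alpha> \<in> (\<lambda>f. differential A f m) ` smooth_functions A" using f by blast
  qed
qed

lemma characteristic_distribution_eq_range:
  assumes "is_sharp n (tangent_space A m) (P m) (sharp n (tangent_space A m) (P m))"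
  shows "characteristic_distribution A n P m =
    sharp n (tangent_space A m) (P m) ` alt_forms (n - 1) (tangent_space A m)"
proof -
  let ?V = "tangent_space A m" and ?d = "\<lambda>f. differential A f m"
  let ?L = "sharp n ?V (P m)"
  obtain c where "finite_frame ?V Basis coordinate_derivation (\<lambda>b. differential A (c b) m)"
    using tangent_finite_frame by blast
  then interpret finite_frame ?V Basis coordinate_derivation "\<lambda>b. differential A (c b) m" .
  have lists: "lists (dual_space ?V) = map ?d ` lists (smooth_functions A)"
    using cotangent_space_eq by (simp add: cotangent_space_def lists_image)
  have "{hamiltonian_vector_field A n P fs m | fs. length fs = n - 1 \<and> set fs \<subseteq> smooth_functions A} =
      {?L (wedge ?V \<alpha>s) | \<alpha>s. length \<alpha>s = n - 1 \<and> set \<alpha>s \<subseteq> dual_space ?V}"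
    (is "?H = ?K")
  proof
    show "?H \<subseteq> ?K"
    proof
      fix x assume "x \<in> ?H"
      then obtain fs where fs: "length fs = n - 1" "fs \<in> lists (smooth_functions A)"
        "x = ?L (wedge ?V (map ?d fs))"
        by (auto simp: hamiltonian_vector_field_def)
      then have "map ?d fs \<in> lists (dual_space ?V)" unfolding lists by blast
      then show "x \<in> ?K" using fs by (auto simp: in_lists_conv_set intro!: exI[of _ "map ?d fs"])
    qed
    show "?K \<subseteq> ?H"
    proof
      fix x assume "x \<in> ?K"
      then obtain \<alpha>s where \<alpha>s: "length \<alpha>s = n - 1" "\<alpha>s \<in> lists (dual_space ?V)" "x = ?L (wedge ?V \<alpha>s)"
        by auto
      then obtain fs where "fs \<in> lists (smooth_functions A)" "\<alpha>s = map ?d fs"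
        unfolding lists by blast
      then show "x \<in> ?H" using \<alpha>s by (auto simp: hamiltonian_vector_field_def in_lists_conv_set)
    qed
  qed
  then show ?thesis
    unfolding characteristic_distribution_def using span_sharp_wedge[OF assms] by simp
qed

end

section \<open>Characteristic distributions of gauge equivalent structures\<close>

theorem mainTheorem10:
  fixes X :: "'a topology" and A :: "('a, 'b::euclidean_space) atlas"
    and n :: nat and P :: "'a multivector_field" and B :: "'a form_field"
  assumes "smooth_manifold X A"
    and "n \<ge> 3"
    and "nambu_poisson_tensor A n P"
    and "closed_form A n B"
    and "gauge_invertible A n P B"
  shows "\<forall>m\<in>topspace X.
    characteristic_distribution A n P m =
    characteristic_distribution A n (gauge_transformation A n B P) m"
proof
  fix m assume "m \<in> topspace X"
  then obtain U \<phi> where U: "(U, \<phi>) \<in> A" "m \<in> U"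
    using assms(1) unfolding smooth_manifold_def by blast
  interpret chart_at X A U \<phi> m by unfold_locales (use assms(1) U in auto)
  let ?V = "tangent_space A m" and ?Q = "gauge_transformation A n B P"
  obtain c where "finite_frame ?V Basis coordinate_derivation (\<lambda>b. differential A (c b) m)"
    using tangent_finite_frame by blast
  then interpret finite_frame ?V Basis coordinate_derivation "\<lambda>b. differential A (c b) m" .
  have m: "m \<in> points A" using U by (auto simp: points_def)
  have n: "n \<ge> 1" using assms(2) by simp
  have P: "P m \<in> alt_forms n (dual_space ?V)"
    using assms(3) m by (simp add: nambu_poisson_tensor_def cotangent_space_def)
  have B: "B m \<in> alt_forms n ?V"
    using assms(4) m by (simp add: closed_form_def smooth_forms_def)
  have bij: "bij_betw (id_plus_flat_sharp n ?V (P m) (B m)) (alt_forms (n - 1) ?V) (alt_forms (n - 1) ?V)"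
    using assms(5) m by (simp add: gauge_invertible_def)
  have Q: "?Q m (\<alpha>s @ [\<beta>]) = \<beta> (sharp n ?V (P m)
      (inv_into (alt_forms (n - 1) ?V) (id_plus_flat_sharp n ?V (P m) (B m)) (wedge ?V \<alpha>s)))"
    if "length \<alpha>s = n - 1" "set \<alpha>s \<subseteq> dual_space ?V" "\<beta> \<in> dual_space ?V" for \<alpha>s \<beta>
    using that n by (simp add: gauge_transformation_def cotangent_space_def)
  have gauge: "is_sharp n ?V (?Q m) (sharp n ?V (?Q m))"
    "sharp n ?V (?Q m) ` alt_forms (n - 1) ?V = sharp n ?V (P m) ` alt_forms (n - 1) ?V"
    by (rule sharp_gauge[OF P n B bij] Q | assumption)+
  show "characteristic_distribution A n P m = characteristic_distribution A n ?Q m"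
    unfolding characteristic_distribution_eq_range[of n P, OF is_sharp_sharp[OF P n]]
      characteristic_distribution_eq_range[of n ?Q, OF gauge(1)] gauge(2) ..
qed

end
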